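(* Let $K$ be a field, $R=K[[t_1,\ldots,t_m]]$, and let $>$ be a $\underline{t}$-local monomial ordering on $\mathrm{Mon}^s(\underline{t},\underline{x})$. Let $f,g_1,\ldots,g_k\in R[\underline{x}]^s$ be $\underline{x}$-homogeneous. Then there exist uniquely determined $q_1,\ldots,q_k\in R[\underline{x}]$ and $r\in R[\underline{x}]^s$ such that $$f=q_1\cdot g_1+\ldots+q_k\cdot g_k+r$$ satisfying: (DD1) for $j<i$ no term of $q_i\cdot \mathrm{lm}_>(g_i)$ is divisible by $\mathrm{lm}_>(g_j)$; (DD2) no term of $r$ is divisible by $\mathrm{lm}_>(g_i)$ for $i=1,\ldots,k$; (DDH) $q_1,\ldots,q_k,r$ are $\underline{x}$-homogeneous of $\underline{x}$-degrees $\deg_{\underline{x}}(q_i)=\deg_{\underline{x}}(f)-\deg_{\underline{x}}\big(\mathrm{lm}_>(g_i)\big)$ respectively $\deg_{\underline{x}}(r)=\deg_{\underline{x}}(f)$.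
   Context: $R[\underline{x}]=K[[t_1,\ldots,t_m]][x_1,\ldots,x_n]$ is the polynomial ring in $\underline{x}=(x_1,\ldots,x_n)$ over the formal power series ring $R$ in $\underline{t}=(t_1,\ldots,t_m)$, and $s\geq 1$. $\mathrm{Mon}(\underline{t},\underline{x})=\{\underline{t}^\alpha\underline{x}^\beta\mid\alpha\in\mathbb{N}^m,\beta\in\mathbb{N}^n\}$ and $\mathrm{Mon}^s(\underline{t},\underline{x})=\{\underline{t}^\alpha\underline{x}^\beta e_i\mid \alpha\in\mathbb{N}^m,\beta\in\mathbb{N}^n,1\le i\le s\}$, with $e_i$ the $i$-th unit vector. For $p,p'\in\mathrm{Mon}^s(\underline{t},\underline{x})\cup\{0\}$, $p$ divides $p'$ if $p'=\underline{t}^\alpha\underline{x}^\beta p$ for some $\alpha,\beta$ (for monomials, in particular, both involve the same $e_i$); a term (non-zero scalar times a monomial) is divisible by $p$ if its monomial is. A monomial ordering on $\mathrm{Mon}(\underline{t},\underline{x})$ is a total ordering compatible with multiplication. A monomial ordering on $\mathrm{Mon}^s(\underline{t},\underline{x})$ is a total ordering $>$ such that $p>p'$ implies $\underline{t}^\alpha\underline{x}^\beta p>\underline{t}^\alpha\underline{x}^\beta p'$ for all $\alpha,\beta$, and for which there is a monomial ordering on $\mathrm{Mon}(\underline{t},\underline{x})$ (the induced one, also denoted $>$) such that $\underline{t}^\alpha\underline{x}^\beta>\underline{t}^{\alpha'}\underline{x}^{\beta'}\Leftrightarrow\underline{t}^\alpha\underline{x}^\beta e_i>\underline{t}^{\alpha'}\underline{x}^{\beta'}e_i$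 for each $i$. It is $\underline{t}$-local if $t_i<1$ for all $i=1,\ldots,m$ in the induced ordering. For $0\ne f\in R[\underline{x}]^s$, $\mathrm{lm}_>(f)$ is the largest monomial occurring in $f$ with non-zero coefficient (it exists by $\underline{t}$-locality), and $\mathrm{lm}_>(0):=0$. The $\underline{x}$-degree $\deg_{\underline{x}}(f)$ is the maximum of $|\beta|=\beta_1+\ldots+\beta_n$ over all monomials $\underline{t}^\alpha\underline{x}^\beta e_i$ occurring in $f$ with non-zero coefficient. An element is $\underline{x}$-homogeneous of $\underline{x}$-degree $d$ if all its terms have the same $\underline{x}$-degree $d$; by this definition $0$ is $\underline{x}$-homogeneous of degree $d$ for all $d\in\mathbb{N}$. The same notions apply to $R[\underline{x}]$ (the case $s=1$). *)

theory Defs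
  imports
    "HOL-Library.Poly_Mapping"
    "HOL-Library.Function_Algebras"
    "HOL-Library.Product_Plus"
    "HOL-Library.Extended_Real"
    "HOL-Library.FuncSet"
begin

section \<open>Formal power series in several variables\<close>

text \<open>
  The ambient type has one variable for every natural number; the ring
  \<open>K[[t\<^sub>1,\<dots>,t\<^sub>m]]\<close> is the subring \<open>power_series_ring m\<close> below. Working with subrings
  rather than with a type of variables keeps \<open>m\<close> an arbitrary natural number, \<open>0\<close> included
  (and likewise for the number \<open>n\<close> of polynomial variables).
\<close>

type_synonym expo = "nat \<Rightarrow>\<^sub>0 nat"

typedef 'a mpseries = "UNIV :: (expo \<Rightarrow> 'a) set"
  morphisms coeff_ps Abs_mpseries ..

setup_lifting type_definition_mpseries

lemma mpseries_eqI: "(\<And>\<gamma>. coeff_ps f \<gamma> = coeff_ps g \<gamma>) \<Longrightarrow> f = g"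
  by transfer auto

definition splits :: "expo \<Rightarrow> (expo \<times> expo) set"
  where "splits \<gamma> = {(\<alpha>, \<beta>). \<alpha> + \<beta> = \<gamma>}"

lemma finite_splits [simp]: "finite (splits \<gamma>)"
proof -
  let ?H = "{h. \<forall>i. (i \<in> Poly_Mapping.keys \<gamma> \<longrightarrow> h i \<in> {..Max (range (Poly_Mapping.lookup \<gamma>))}) \<and>
    (i \<notin> Poly_Mapping.keys \<gamma> \<longrightarrow> h i = 0)}"
  have fr: "finite (range (Poly_Mapping.lookup \<gamma>))"
  proof -
    have "range (Poly_Mapping.lookup \<gamma>) \<subseteq> insert 0 (Poly_Mapping.lookup \<gamma> ` Poly_Mapping.keys \<gamma>)"
      by (auto simp: in_keys_iff)
    then show ?thesis
      by (rule finite_subset) simp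
  qed
  have fH: "finite ?H"
    by (rule finite_set_of_finite_funs) auto
  let ?A = "{\<alpha>. Poly_Mapping.lookup \<alpha> \<in> ?H}"
  have fA: "finite ?A"
  proof (rule finite_imageD)
    show "finite (Poly_Mapping.lookup ` ?A)"
      by (rule finite_subset [OF _ fH]) auto
    show "inj_on Poly_Mapping.lookup ?A"
      by (auto intro!: inj_onI poly_mapping_eqI)
  qed
  have "Poly_Mapping.lookup \<alpha> \<in> ?H \<and> Poly_Mapping.lookup \<beta> \<in> ?H" if "\<alpha> + \<beta> = \<gamma>" for \<alpha> \<beta>
  proof -
    have *: "Poly_Mapping.lookup \<gamma> i = Poly_Mapping.lookup \<alpha> i + Poly_Mapping.lookup \<beta> i" for i
      using that by (auto simp: lookup_add)
    have "Poly_Mapping.lookup \<gamma> i \<le> Max (range (Poly_Mapping.lookup \<gamma>))" for i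
      using fr by auto
    with * have "Poly_Mapping.lookup \<alpha> i \<le> Max (range (Poly_Mapping.lookup \<gamma>)) \<and>
        Poly_Mapping.lookup \<beta> i \<le> Max (range (Poly_Mapping.lookup \<gamma>))" for i
      by (metis add_leD1 add_leD2)
    moreover have "Poly_Mapping.lookup \<alpha> i = 0 \<and> Poly_Mapping.lookup \<beta> i = 0" if "i \<notin> Poly_Mapping.keys \<gamma>" for i
      using * [of i] that by (simp add: in_keys_iff)
    ultimately show ?thesis by auto
  qed
  then have "splits \<gamma> \<subseteq> ?A \<times> ?A"
    by (auto simp: splits_def)
  then show ?thesis
    using fA by (meson finite_SigmaI finite_subset)
qed

instantiation mpseries :: (comm_ring_1) comm_ring_1
begin

lift_definition zero_mpseries :: "'a mpseries" is "\<lambda>_. 0" .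
lift_definition one_mpseries :: "'a mpseries" is "\<lambda>\<alpha>. if \<alpha> = 0 then 1 else 0" .
lift_definition plus_mpseries :: "'a mpseries \<Rightarrow> 'a mpseries \<Rightarrow> 'a mpseries"
  is "\<lambda>f g \<alpha>. f \<alpha> + g \<alpha>" .
lift_definition minus_mpseries :: "'a mpseries \<Rightarrow> 'a mpseries \<Rightarrow> 'a mpseries"
  is "\<lambda>f g \<alpha>. f \<alpha> - g \<alpha>" .
lift_definition uminus_mpseries :: "'a mpseries \<Rightarrow> 'a mpseries"
  is "\<lambda>f \<alpha>. - f \<alpha>" .
lift_definition times_mpseries :: "'a mpseries \<Rightarrow> 'a mpseries \<Rightarrow> 'a mpseries"
  is "\<lambda>f g \<gamma>. \<Sum>(\<alpha>, \<beta>)\<in>splits \<gamma>. f \<alpha> * g \<beta>" .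

instance
proof
  fix a b c :: "'a mpseries"
  show "a * b * c = a * (b * c)"
  proof (rule mpseries_eqI)
    fix \<gamma>
    let ?f = "coeff_ps a" and ?g = "coeff_ps b" and ?h = "coeff_ps c"
    have "coeff_ps (a * b * c) \<gamma> =
        (\<Sum>p\<in>splits \<gamma>. \<Sum>q\<in>splits (fst p). ?f (fst q) * ?g (snd q) * ?h (snd p))"
      by (simp add: times_mpseries.rep_eq case_prod_beta sum_distrib_right)
    also have "\<dots> = (\<Sum>(p, q)\<in>(SIGMA p:splits \<gamma>. splits (fst p)). ?f (fst q) * ?g (snd q) * ?h (snd p))"
      by (subst sum.Sigma) auto
    also have "\<dots> = (\<Sum>(p, q)\<in>(SIGMA p:splits \<gamma>. splits (snd p)). ?f (fst p) * (?g (fst q) * ?h (snd q)))"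
      by (rule sum.reindex_bij_witness
            [where j = "\<lambda>((u, w), (x, y)). ((x, y + w), (y, w))"
               and i = "\<lambda>((x, v), (y, w)). ((x + y, w), (x, y))"])
         (auto simp: splits_def ac_simps)
    also have "\<dots> = (\<Sum>p\<in>splits \<gamma>. \<Sum>q\<in>splits (snd p). ?f (fst p) * (?g (fst q) * ?h (snd q)))"
      by (subst sum.Sigma) auto
    also have "\<dots> = coeff_ps (a * (b * c)) \<gamma>"
      by (simp add: times_mpseries.rep_eq case_prod_beta sum_distrib_left)
    finally show "coeff_ps (a * b * c) \<gamma> = coeff_ps (a * (b * c)) \<gamma>" .
  qed
  show "a * b = b * a"
  proof (rule mpseries_eqI)
    fix \<gamma>
    show "coeff_ps (a * b) \<gamma> = coeff_ps (b * a) \<gamma>"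
      unfolding times_mpseries.rep_eq
      by (rule sum.reindex_bij_witness [where i = prod.swap and j = prod.swap])
         (auto simp: splits_def ac_simps)
  qed
  show "1 * a = a"
  proof (rule mpseries_eqI)
    fix \<gamma>
    have "coeff_ps (1 * a) \<gamma> = (\<Sum>p\<in>splits \<gamma>. (if fst p = 0 then 1 else 0) * coeff_ps a (snd p))"
      by (simp add: times_mpseries.rep_eq one_mpseries.rep_eq case_prod_beta)
    also have "\<dots> = (\<Sum>p\<in>{(0 :: expo, \<gamma>)}. (if fst p = 0 then 1 else 0) * coeff_ps a (snd p))"
      by (rule sum.mono_neutral_right [OF finite_splits]) (auto simp: splits_def)
    finally show "coeff_ps (1 * a) \<gamma> = coeff_ps a \<gamma>" by simp
  qed
  show "(a + b) * c = a * c + b * c"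
    by (rule mpseries_eqI)
       (simp add: times_mpseries.rep_eq plus_mpseries.rep_eq case_prod_beta
          distrib_right sum.distrib)
  show "(0 :: 'a mpseries) \<noteq> 1"
    by transfer (metis zero_neq_one)
qed (transfer; auto simp: algebra_simps)+

end

definition power_series_ring :: "nat \<Rightarrow> 'a::comm_ring_1 mpseries set"
  where "power_series_ring m = {c. \<forall>\<alpha>. coeff_ps c \<alpha> \<noteq> 0 \<longrightarrow> Poly_Mapping.keys \<alpha> \<subseteq> {1..m}}"

definition t_monom :: "expo \<Rightarrow> 'a::comm_ring_1 mpseries"
  where "t_monom \<alpha> = Abs_mpseries (\<lambda>\<gamma>. if \<gamma> = \<alpha> then 1 else 0)"


section \<open>The ring \<open>R[x]\<close> and the free module \<open>R[x]\<^sup>s\<close>\<close>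

type_synonym 'a rx = "expo \<Rightarrow>\<^sub>0 'a mpseries"

definition poly_ring :: "nat \<Rightarrow> nat \<Rightarrow> 'a::comm_ring_1 rx set"
  where "poly_ring m n =
    {p. \<forall>\<beta>\<in>Poly_Mapping.keys p. Poly_Mapping.keys \<beta> \<subseteq> {1..n} \<and>
      Poly_Mapping.lookup p \<beta> \<in> power_series_ring m}"

text \<open>
  Vectors are functions on the index set \<open>{1..s}\<close> extended by \<open>0\<close>, so that the pointwise
  operations on functions are the module operations.
\<close>

type_synonym 'a rxv = "nat \<Rightarrow> 'a rx"

definition free_module :: "nat \<Rightarrow> nat \<Rightarrow> nat \<Rightarrow> 'a::comm_ring_1 rxv set"
  where "free_module m n s =
    {f. (\<forall>i\<in>{1..s}. f i \<in> poly_ring m n) \<and> (\<forall>i. i \<notin> {1..s} \<longrightarrow> f i = 0)}"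

definition scale :: "'a::comm_ring_1 rx \<Rightarrow> 'a rxv \<Rightarrow> 'a rxv"  (infixr \<open>\<odot>\<close> 70)
  where "q \<odot> f = (\<lambda>i. q * f i)"

definition unit_vec :: "nat \<Rightarrow> 'a::comm_ring_1 rxv"
  where "unit_vec i = (\<lambda>j. if j = i then 1 else 0)"


section \<open>Monomials\<close>

text \<open>
  The pair \<open>(\<alpha>, \<beta>)\<close> stands for \<open>t\<^sup>\<alpha>x\<^sup>\<beta>\<close> and \<open>((\<alpha>, \<beta>), i)\<close> for \<open>t\<^sup>\<alpha>x\<^sup>\<beta>e\<^sub>i\<close>. Being exponents, they
  are multiplied by adding, and \<open>0\<close> is the monomial \<open>1\<close>.
\<close>

type_synonym mon = "expo \<times> expo"
type_synonym vmon = "mon \<times> nat"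

definition Mon :: "nat \<Rightarrow> nat \<Rightarrow> mon set"
  where "Mon m n = {(\<alpha>, \<beta>). Poly_Mapping.keys \<alpha> \<subseteq> {1..m} \<and> Poly_Mapping.keys \<beta> \<subseteq> {1..n}}"

definition VMon :: "nat \<Rightarrow> nat \<Rightarrow> nat \<Rightarrow> vmon set"
  where "VMon m n s = Mon m n \<times> {1..s}"

definition t_var :: "nat \<Rightarrow> mon"
  where "t_var i = (Poly_Mapping.single i 1, 0)"

definition mon_elt :: "mon \<Rightarrow> 'a::comm_ring_1 rx"
  where "mon_elt p = Poly_Mapping.single (snd p) (t_monom (fst p))"

definition vmon_elt :: "vmon \<Rightarrow> 'a::comm_ring_1 rxv"
  where "vmon_elt u = mon_elt (fst u) \<odot> unit_vec (snd u)"

definition monomials :: "'a::comm_ring_1 rxv \<Rightarrow> vmon set"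
  where "monomials f = {((\<alpha>, \<beta>), i). coeff_ps (Poly_Mapping.lookup (f i) \<beta>) \<alpha> \<noteq> 0}"

text \<open>
  Divisibility on \<open>Mon\<^sup>s(t,x) \<union> {0}\<close>, both regarded as elements of \<open>R[x]\<^sup>s\<close>: \<open>0\<close> divides only \<open>0\<close>.
\<close>

definition mon_dvd :: "nat \<Rightarrow> nat \<Rightarrow> 'a::comm_ring_1 rxv \<Rightarrow> 'a rxv \<Rightarrow> bool"
  where "mon_dvd m n p p' \<longleftrightarrow> (\<exists>a\<in>Mon m n. p' = mon_elt a \<odot> p)"

definition no_term_divisible :: "nat \<Rightarrow> nat \<Rightarrow> 'a::comm_ring_1 rxv \<Rightarrow> 'a rxv \<Rightarrow> bool"
  where "no_term_divisible m n h p \<longleftrightarrow> (\<forall>u\<in>monomials h. \<not> mon_dvd m n p (vmon_elt u))"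


section \<open>Monomial orderings\<close>

text \<open>Orderings are given by their strict part; \<open>gt p p'\<close> is \<open>p > p'\<close>.\<close>

definition total_ordering_on :: "'b set \<Rightarrow> ('b \<Rightarrow> 'b \<Rightarrow> bool) \<Rightarrow> bool"
  where "total_ordering_on A gt \<longleftrightarrow> irreflp_on A gt \<and> transp_on A gt \<and> totalp_on A gt"

definition monomial_ordering :: "nat \<Rightarrow> nat \<Rightarrow> (mon \<Rightarrow> mon \<Rightarrow> bool) \<Rightarrow> bool"
  where "monomial_ordering m n gt \<longleftrightarrow>
    total_ordering_on (Mon m n) gt \<and>
    (\<forall>a\<in>Mon m n. \<forall>p\<in>Mon m n. \<forall>p'\<in>Mon m n. gt p p' \<longrightarrow> gt (a + p) (a + p'))"

definition induced_ordering ::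
    "nat \<Rightarrow> nat \<Rightarrow> nat \<Rightarrow> (vmon \<Rightarrow> vmon \<Rightarrow> bool) \<Rightarrow> (mon \<Rightarrow> mon \<Rightarrow> bool) \<Rightarrow> bool"
  where "induced_ordering m n s gt gt' \<longleftrightarrow>
    monomial_ordering m n gt' \<and>
    (\<forall>i\<in>{1..s}. \<forall>p\<in>Mon m n. \<forall>p'\<in>Mon m n. gt' p p' \<longleftrightarrow> gt (p, i) (p', i))"

definition vmonomial_ordering :: "nat \<Rightarrow> nat \<Rightarrow> nat \<Rightarrow> (vmon \<Rightarrow> vmon \<Rightarrow> bool) \<Rightarrow> bool"
  where "vmonomial_ordering m n s gt \<longleftrightarrow>
    total_ordering_on (VMon m n s) gt \<and>
    (\<forall>a\<in>Mon m n. \<forall>(p, i)\<in>VMon m n s. \<forall>(p', i')\<in>VMon m n s.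
       gt (p, i) (p', i') \<longrightarrow> gt (a + p, i) (a + p', i')) \<and>
    (\<exists>gt'. induced_ordering m n s gt gt')"

text \<open>For \<open>s \<ge> 1\<close> the induced ordering is unique on \<open>Mon m n\<close>.\<close>

definition t_local :: "nat \<Rightarrow> nat \<Rightarrow> nat \<Rightarrow> (vmon \<Rightarrow> vmon \<Rightarrow> bool) \<Rightarrow> bool"
  where "t_local m n s gt \<longleftrightarrow>
    (\<exists>gt'. induced_ordering m n s gt gt' \<and> (\<forall>i\<in>{1..m}. gt' 0 (t_var i)))"

definition lm :: "(vmon \<Rightarrow> vmon \<Rightarrow> bool) \<Rightarrow> 'a::comm_ring_1 rxv \<Rightarrow> 'a rxv"
  where "lm gt f =
    (if f = 0 then 0
     else vmon_elt (THE u. u \<in> monomials f \<and> (\<forall>v\<in>monomials f. v \<noteq> u \<longrightarrow> gt u v)))"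


section \<open>Degree in \<open>x\<close>\<close>

definition mon_xdeg :: "vmon \<Rightarrow> nat"
  where "mon_xdeg = (\<lambda>((\<alpha>, \<beta>), i). \<Sum>j\<in>Poly_Mapping.keys \<beta>. Poly_Mapping.lookup \<beta> j)"

text \<open>
  The maximum over the empty set is \<open>-\<infinity>\<close>, hence \<open>xdeg 0 = -\<infinity>\<close>. Degrees are extended reals so
  that differences of degrees need not be truncated; only \<open>0\<close> is homogeneous of a degree that is
  not a natural number (a negative integer or \<open>\<plusminus>\<infinity>\<close>). In a division with remainder this makes
  the quotient of a zero divisor \<open>g\<^sub>i = 0\<close>, which is otherwise arbitrary, equal to \<open>0\<close>: its degree
  is \<open>deg f - (-\<infinity>) = \<infinity>\<close>.
\<close>

definition xdeg :: "'a::comm_ring_1 rxv \<Rightarrow> ereal"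
  where "xdeg f = (SUP u\<in>monomials f. ereal (real (mon_xdeg u)))"

definition xhomogeneous_of :: "ereal \<Rightarrow> 'a::comm_ring_1 rxv \<Rightarrow> bool"
  where "xhomogeneous_of d f \<longleftrightarrow> (\<forall>u\<in>monomials f. ereal (real (mon_xdeg u)) = d)"

definition xhomogeneous :: "'a::comm_ring_1 rxv \<Rightarrow> bool"
  where "xhomogeneous f \<longleftrightarrow> (\<exists>d::nat. xhomogeneous_of (ereal (real d)) f)"

text \<open>\<open>R[x]\<close> is identified with \<open>R[x]\<^sup>1\<close>, i.e. \<open>q\<close> with \<open>q \<odot> unit_vec 1\<close>.\<close>

definition poly_xhomogeneous_of :: "ereal \<Rightarrow> 'a::comm_ring_1 rx \<Rightarrow> bool"
  where "poly_xhomogeneous_of d q \<longleftrightarrow> xhomogeneous_of d (q \<odot> unit_vec 1)"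

end

theory Submission
  imports Defs
begin

text \<open>
  If every \<open>g\<^sub>i\<close> were a single term, division would be mere sorting: a monomial \<open>v\<close> of the degree of
  \<open>f\<close> goes to the quotient with the least index \<open>i\<close> such that \<open>lm(g\<^sub>i)\<close> divides \<open>v\<close>, or else to the
  remainder. In general, let \<open>c v\<close> be the coefficient of \<open>v\<close> in \<open>\<Sum>i. q\<^sub>i \<cdot> lt(g\<^sub>i) + r\<close>, where \<open>lt\<close> is the
  leading term. The conditions on divisibility and degrees then say exactly that each monomial enters
  this sum only at the place to which the sorting sends it, so that \<open>c\<close> determines \<open>q\<close> and \<open>r\<close>; and
  every function \<open>c\<close> on the monomials of the degree of \<open>f\<close> arises in this way (lemmas
  \<open>decoded_admissible\<close> and \<open>admissible_decoded\<close>).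

  Replacing \<open>lt(g\<^sub>i)\<close> by \<open>g\<^sub>i\<close> changes the coefficient at \<open>v\<close> only by a finite linear combination of values
  \<open>c u\<close> with \<open>u > v\<close> (lemma \<open>coeff_decoded\<close>). Hence the equation \<open>f = \<Sum>i. q\<^sub>i \<cdot> g\<^sub>i + r\<close> is a
  unitriangular system of linear equations for \<open>c\<close>. Among the monomials of a fixed \<open>x\<close>-degree only
  finitely many \<open>x\<^sup>\<beta>e\<^sub>i\<close> occur, and so, by Dickson's argument and \<open>t\<close>-locality, there is no infinite
  ascending chain (lemma \<open>wf_graded_piece\<close>). The system therefore has exactly one solution, found by
  well-founded recursion from the greatest monomials downwards (lemma \<open>unique_solution\<close>). A power
  series being nothing but its family of coefficients, this solution is the required
  division as it stands.
\<close>

section \<open>Coefficients, monomials and divisibility\<close>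

definition coeff_at :: "'a::comm_ring_1 rx \<Rightarrow> mon \<Rightarrow> 'a"
  where "coeff_at p a = coeff_ps (Poly_Mapping.lookup p (snd a)) (fst a)"

text \<open>
  The coefficients being power series, \<open>F\<close> may be arbitrary in \<open>t\<close>; only finitely many
  \<open>x\<close>-exponents may occur (premise of lemma \<open>coeff_at_rx_of_coeffs\<close>).
\<close>

definition rx_of_coeffs :: "(mon \<Rightarrow> 'a::comm_ring_1) \<Rightarrow> 'a rx"
  where "rx_of_coeffs F = Abs_poly_mapping (\<lambda>\<beta>. Abs_mpseries (\<lambda>\<alpha>. F (\<alpha>, \<beta>)))"

definition mon_splits :: "mon \<Rightarrow> (mon \<times> mon) set"
  where "mon_splits c = {(a, b). a + b = c}"

lemma monomials_iff: "u \<in> monomials f \<longleftrightarrow> coeff_at (f (snd u)) (fst u) \<noteq> 0"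
  by (cases u) (auto simp: monomials_def coeff_at_def split: prod.splits)

lemma rx_eqI: "(\<And>a. coeff_at p a = coeff_at q a) \<Longrightarrow> p = q"
  by (intro poly_mapping_eqI mpseries_eqI) (metis coeff_at_def fst_conv snd_conv)

lemma rxv_eqI:
  assumes "\<And>u. coeff_at (f (snd u)) (fst u) = coeff_at (h (snd u)) (fst u)"
  shows "f = h"
proof (rule ext, rule rx_eqI)
  fix i a
  show "coeff_at (f i) a = coeff_at (h i) a"
    using assms[of "(a, i)"] by simp
qed

lemma coeff_at_0 [simp]: "coeff_at 0 a = 0"
  by (simp add: coeff_at_def zero_mpseries.rep_eq)

lemma coeff_at_add: "coeff_at (p + q) a = coeff_at p a + coeff_at q a"
  by (simp add: coeff_at_def lookup_add plus_mpseries.rep_eq)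

lemma coeff_at_sum: "coeff_at (\<Sum>i\<in>S. p i) a = (\<Sum>i\<in>S. coeff_at (p i) a)"
  by (induction S rule: infinite_finite_induct) (auto simp: coeff_at_add)

lemma coeff_at_rx_of_coeffs:
  assumes "finite {\<beta>. \<exists>\<alpha>. F (\<alpha>, \<beta>) \<noteq> 0}"
  shows "coeff_at (rx_of_coeffs F) a = F a"
proof -
  have "{\<beta>. Abs_mpseries (\<lambda>\<alpha>. F (\<alpha>, \<beta>)) \<noteq> 0} \<subseteq> {\<beta>. \<exists>\<alpha>. F (\<alpha>, \<beta>) \<noteq> 0}"
    by (auto simp: zero_mpseries_def intro!: arg_cong[where f = Abs_mpseries])
  then have "finite {\<beta>. Abs_mpseries (\<lambda>\<alpha>. F (\<alpha>, \<beta>)) \<noteq> 0}"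
    using assms finite_subset by blast
  then show ?thesis
    by (simp add: coeff_at_def rx_of_coeffs_def Abs_mpseries_inverse)
qed

lemma finite_mon_splits [simp]: "finite (mon_splits c)"
proof (rule finite_subset)
  show "mon_splits c \<subseteq> (\<lambda>((a, a'), (b, b')). ((a, b), (a', b'))) ` (splits (fst c) \<times> splits (snd c))"
    by (force simp: mon_splits_def splits_def image_iff)
qed auto

lemma lookup_mult_splits:
  "Poly_Mapping.lookup (p * q) \<gamma> =
     (\<Sum>(a, b)\<in>splits \<gamma>. Poly_Mapping.lookup p a * Poly_Mapping.lookup q b)"
  for p q :: "'a::comm_ring_1 rx"
proof -
  have "Poly_Mapping.lookup (p * q) \<gamma> =
      (\<Sum>(a, b). Poly_Mapping.lookup p a * Poly_Mapping.lookup q b when \<gamma> = a + b)"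
    unfolding times_poly_mapping.rep_eq by (rule prod_fun_unfold_prod) auto
  also have "\<dots> = (\<Sum>(a, b)\<in>splits \<gamma>. (Poly_Mapping.lookup p a * Poly_Mapping.lookup q b when \<gamma> = a + b))"
    by (rule Sum_any.expand_superset[OF finite_splits]) (auto simp: splits_def when_def split: if_splits)
  also have "\<dots> = (\<Sum>(a, b)\<in>splits \<gamma>. Poly_Mapping.lookup p a * Poly_Mapping.lookup q b)"
    by (rule sum.cong) (auto simp: splits_def when_def)
  finally show ?thesis .
qed

lemma coeff_ps_sum: "coeff_ps (\<Sum>i\<in>S. p i) a = (\<Sum>i\<in>S. coeff_ps (p i) a)"
  by (induction S rule: infinite_finite_induct)
     (auto simp: plus_mpseries.rep_eq zero_mpseries.rep_eq)

lemma coeff_at_mult: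
  "coeff_at (p * q) c = (\<Sum>(a, b)\<in>mon_splits c. coeff_at p a * coeff_at q b)"
proof -
  have "coeff_at (p * q) c =
      (\<Sum>y\<in>splits (snd c). \<Sum>x\<in>splits (fst c).
         coeff_at p (fst x, fst y) * coeff_at q (snd x, snd y))"
    by (simp add: coeff_at_def lookup_mult_splits coeff_ps_sum case_prod_beta times_mpseries.rep_eq)
  also have "\<dots> = (\<Sum>(y, x)\<in>splits (snd c) \<times> splits (fst c).
         coeff_at p (fst x, fst y) * coeff_at q (snd x, snd y))"
    by (rule sum.cartesian_product)
  also have "\<dots> = (\<Sum>(a, b)\<in>mon_splits c. coeff_at p a * coeff_at q b)"
    by (rule sum.reindex_bij_witness
          [where j = "\<lambda>(y, x). ((fst x, fst y), (snd x, snd y))"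
             and i = "\<lambda>(a, b). ((snd a, snd b), (fst a, fst b))"])
       (auto simp: mon_splits_def splits_def)
  finally show ?thesis .
qed

lemma coeff_at_mon_elt: "coeff_at (mon_elt p) a = (if a = p then 1 else 0)"
  by (cases p, cases a)
     (auto simp: coeff_at_def mon_elt_def t_monom_def lookup_single when_def
        Abs_mpseries_inverse zero_mpseries.rep_eq)

lemma coeff_at_mult_mon_elt: "coeff_at (q * mon_elt p) (a + p) = coeff_at q a"
proof -
  have "coeff_at (q * mon_elt p) (a + p) =
      (\<Sum>(x, y)\<in>{(a, p)}. coeff_at q x * coeff_at (mon_elt p) y)"
    unfolding coeff_at_mult
  proof (rule sum.mono_neutral_right[OF finite_mon_splits], goal_cases)
    case 2
    have "coeff_at q x * coeff_at (mon_elt p) y = 0" if "x + y = a + p" "(x, y) \<noteq> (a, p)" for x y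
      using that by (cases "y = p") (simp_all add: coeff_at_mon_elt)
    then show ?case
      by (simp add: mon_splits_def case_prod_beta split_beta) fastforce
  qed (simp add: mon_splits_def)
  then show ?thesis by (simp add: coeff_at_mon_elt)
qed

lemma coeff_at_mult_mon_elt_nonzero:
  assumes "coeff_at (q * mon_elt p) c \<noteq> 0"
  obtains a where "c = a + p" "coeff_at q a \<noteq> 0"
proof -
  obtain x where "x \<in> mon_splits c" "(case x of (a, b) \<Rightarrow> coeff_at q a * coeff_at (mon_elt p) b) \<noteq> 0"
    using assms unfolding coeff_at_mult by (rule sum.not_neutral_contains_not_neutral)
  then show ?thesis
    using that by (cases x) (auto simp: mon_splits_def coeff_at_mon_elt split: if_splits)
qed

lemma vmon_elt_apply: "vmon_elt u i = (if i = snd u then mon_elt (fst u) else 0)"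
  by (simp add: vmon_elt_def scale_def unit_vec_def)

lemma monomials_vmon_elt: "monomials (vmon_elt u :: 'a::comm_ring_1 rxv) = {u}"
  by (auto simp: monomials_iff vmon_elt_apply coeff_at_mon_elt prod_eq_iff split: if_splits)

lemma monomials_empty_iff: "monomials f = {} \<longleftrightarrow> f = 0"
proof
  assume "monomials f = {}"
  then show "f = 0"
    by (intro rxv_eqI) (auto simp: set_eq_iff monomials_iff)
qed (auto simp: set_eq_iff monomials_iff)

lemma monomials_scale_vmon_elt:
  "monomials (q \<odot> vmon_elt w) = {(a + fst w, snd w) |a. coeff_at q a \<noteq> 0}"
proof (rule set_eqI)
  fix u :: vmon
  show "u \<in> monomials (q \<odot> vmon_elt w) \<longleftrightarrow> u \<in> {(a + fst w, snd w) |a. coeff_at q a \<noteq> 0}"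
    by (cases u)
       (auto simp: monomials_iff scale_def vmon_elt_apply coeff_at_mult_mon_elt
          elim: coeff_at_mult_mon_elt_nonzero)
qed

lemma monomials_scale_unit_vec: "monomials (q \<odot> unit_vec i) = {(a, i) |a. coeff_at q a \<noteq> 0}"
  by (auto simp: monomials_iff scale_def unit_vec_def split: if_splits)

lemma poly_ring_iff: "q \<in> poly_ring m n \<longleftrightarrow> (\<forall>a. coeff_at q a \<noteq> 0 \<longrightarrow> a \<in> Mon m n)"
proof
  assume *: "q \<in> poly_ring m n"
  show "\<forall>a. coeff_at q a \<noteq> 0 \<longrightarrow> a \<in> Mon m n"
  proof (intro allI impI)
    fix a assume a: "coeff_at q a \<noteq> 0"
    then have "snd a \<in> Poly_Mapping.keys q"
      by (auto simp: coeff_at_def in_keys_iff zero_mpseries.rep_eq)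
    with * a show "a \<in> Mon m n"
      by (simp add: poly_ring_def power_series_ring_def coeff_at_def Mon_def case_prod_beta mem_Times_iff)
  qed
next
  assume *: "\<forall>a. coeff_at q a \<noteq> 0 \<longrightarrow> a \<in> Mon m n"
  show "q \<in> poly_ring m n"
    unfolding poly_ring_def
  proof (intro CollectI ballI conjI)
    fix \<beta> assume "\<beta> \<in> Poly_Mapping.keys q"
    then obtain \<alpha> where "coeff_at q (\<alpha>, \<beta>) \<noteq> 0"
      by (metis coeff_at_def fst_conv in_keys_iff mpseries_eqI snd_conv zero_mpseries.rep_eq)
    with * show "Poly_Mapping.keys \<beta> \<subseteq> {1..n}"
      by (force simp: Mon_def)
    show "Poly_Mapping.lookup q \<beta> \<in> power_series_ring m"
      unfolding power_series_ring_def
    proof (intro CollectI allI impI)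
      fix \<alpha> assume "coeff_ps (Poly_Mapping.lookup q \<beta>) \<alpha> \<noteq> 0"
      with * have "(\<alpha>, \<beta>) \<in> Mon m n"
        by (simp add: coeff_at_def)
      then show "Poly_Mapping.keys \<alpha> \<subseteq> {1..m}"
        by (simp add: Mon_def)
    qed
  qed
qed

lemma free_module_iff: "f \<in> free_module m n s \<longleftrightarrow> monomials f \<subseteq> VMon m n s"
proof
  assume "f \<in> free_module m n s"
  then show "monomials f \<subseteq> VMon m n s"
    by (auto simp: free_module_def poly_ring_iff VMon_def monomials_iff) 
      (metis coeff_at_0 atLeastAtMost_iff One_nat_def)+
next
  assume *: "monomials f \<subseteq> VMon m n s"
  have "f i = 0" if "i \<notin> {1..s}" for i
    using * that by (intro rx_eqI) (force simp: monomials_iff VMon_def subset_iff)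
  moreover have "f i \<in> poly_ring m n" if "i \<in> {1..s}" for i
    using * that by (force simp: poly_ring_iff monomials_iff VMon_def subset_iff)
  ultimately show "f \<in> free_module m n s"
    by (auto simp: free_module_def)
qed

text \<open>
  Divisibility of monomials expressed by exponents. It agrees with divisibility of the corresponding
  elements of the free module (lemma \<open>mon_dvd_vmon_elt\<close>), so that everything below can be said
  about supports of coefficient functions.
\<close>

definition vmon_dvd :: "nat \<Rightarrow> nat \<Rightarrow> vmon \<Rightarrow> vmon \<Rightarrow> bool"
  where "vmon_dvd m n w u \<longleftrightarrow> snd w = snd u \<and> (\<exists>a\<in>Mon m n. fst u = a + fst w)"

lemma mon_elt_mult: "mon_elt a * mon_elt p = mon_elt (a + p)"
proof (rule rx_eqI)
  fix c
  show "coeff_at (mon_elt a * mon_elt p) c = coeff_at (mon_elt (a + p)) c"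
  proof (cases "\<exists>b. c = b + p")
    case True
    then show ?thesis
      by (metis coeff_at_mult_mon_elt coeff_at_mon_elt add_right_cancel)
  next
    case False
    then have "coeff_at (mon_elt a * mon_elt p) c = 0"
      using coeff_at_mult_mon_elt_nonzero by blast
    moreover have "c \<noteq> a + p" using False by blast
    ultimately show ?thesis
      by (simp add: coeff_at_mon_elt)
  qed
qed

lemma mon_elt_scale_vmon_elt: "mon_elt a \<odot> vmon_elt w = vmon_elt (a + fst w, snd w)"
  by (rule ext) (auto simp: scale_def vmon_elt_apply mon_elt_mult)

lemma vmon_elt_eq_iff [simp]:
  "(vmon_elt u :: 'a::comm_ring_1 rxv) = vmon_elt w \<longleftrightarrow> u = w"
  by (metis monomials_vmon_elt the_elem_eq)

lemma vmon_elt_nonzero [simp]: "(vmon_elt u :: 'a::comm_ring_1 rxv) \<noteq> 0"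
  by (metis monomials_vmon_elt monomials_empty_iff insert_not_empty)

lemma mon_dvd_vmon_elt:
  "mon_dvd m n (vmon_elt w :: 'a::comm_ring_1 rxv) (vmon_elt u) \<longleftrightarrow> vmon_dvd m n w u"
  by (cases u) (auto simp: mon_dvd_def vmon_dvd_def mon_elt_scale_vmon_elt)

lemma not_mon_dvd_zero: "\<not> mon_dvd m n 0 (vmon_elt u :: 'a::comm_ring_1 rxv)"
  by (auto simp: mon_dvd_def scale_def zero_fun_def[symmetric])

lemma no_term_divisible_iff:
  "no_term_divisible m n h (vmon_elt w :: 'a::comm_ring_1 rxv) \<longleftrightarrow>
     (\<forall>u\<in>monomials h. \<not> vmon_dvd m n w u)"
  by (simp add: no_term_divisible_def mon_dvd_vmon_elt)

section \<open>Degree in the polynomial variables\<close>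

definition deg_expo :: "expo \<Rightarrow> nat"
  where "deg_expo \<beta> = (\<Sum>j\<in>Poly_Mapping.keys \<beta>. Poly_Mapping.lookup \<beta> j)"

lemma mon_xdeg_eq: "mon_xdeg u = deg_expo (snd (fst u))"
  by (simp add: mon_xdeg_def deg_expo_def split: prod.splits)

lemma deg_expo_superset:
  "finite S \<Longrightarrow> Poly_Mapping.keys \<beta> \<subseteq> S \<Longrightarrow> deg_expo \<beta> = (\<Sum>j\<in>S. Poly_Mapping.lookup \<beta> j)"
  unfolding deg_expo_def by (rule sum.mono_neutral_left) (auto simp: in_keys_iff)

lemma keys_expo_add: "Poly_Mapping.keys (\<alpha> + \<beta>) = Poly_Mapping.keys \<alpha> \<union> Poly_Mapping.keys \<beta>"
  for \<alpha> \<beta> :: expo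
  by (auto simp: in_keys_iff lookup_add)

lemma deg_expo_add: "deg_expo (\<alpha> + \<beta>) = deg_expo \<alpha> + deg_expo \<beta>"
proof -
  let ?S = "Poly_Mapping.keys \<alpha> \<union> Poly_Mapping.keys \<beta>"
  have "deg_expo (\<alpha> + \<beta>) = (\<Sum>j\<in>?S. Poly_Mapping.lookup (\<alpha> + \<beta>) j)"
    by (rule deg_expo_superset) (auto simp: keys_expo_add)
  also have "\<dots> = deg_expo \<alpha> + deg_expo \<beta>"
    by (simp add: deg_expo_superset[of ?S] lookup_add sum.distrib)
  finally show ?thesis .
qed

lemma mon_xdeg_add: "mon_xdeg (a + b, i) = mon_xdeg (a, j) + mon_xdeg (b, l)"
  by (simp add: mon_xdeg_eq deg_expo_add)

lemma Mon_add_iff: "a + b \<in> Mon m n \<longleftrightarrow> a \<in> Mon m n \<and> b \<in> Mon m n"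
  by (cases a, cases b) (auto simp: Mon_def keys_expo_add)

text \<open>
  All exponents in question are summands of the single exponent \<open>(d, \<dots>, d)\<close>, which splits in
  finitely many ways.
\<close>

lemma finite_expo_of_degree: "finite {\<beta>. Poly_Mapping.keys \<beta> \<subseteq> {1..n} \<and> deg_expo \<beta> = d}"
proof (rule finite_subset)
  let ?b = "\<Sum>j\<in>{1..n}. Poly_Mapping.single j d"
  show "{\<beta>. Poly_Mapping.keys \<beta> \<subseteq> {1..n} \<and> deg_expo \<beta> = d} \<subseteq> fst ` splits ?b"
  proof clarify
    fix \<beta> assume *: "Poly_Mapping.keys \<beta> \<subseteq> {1..n}" "d = deg_expo \<beta>"
    have "\<beta> + (?b - \<beta>) = ?b"
    proof (rule poly_mapping_eqI)
      fix j
      have "Poly_Mapping.lookup \<beta> j \<le> Poly_Mapping.lookup ?b j"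
      proof (cases "j \<in> Poly_Mapping.keys \<beta>")
        case True
        then have "Poly_Mapping.lookup \<beta> j \<le> d"
          unfolding *(2) deg_expo_def by (intro member_le_sum) auto
        moreover have "j \<in> {1..n}" using True * by auto
        ultimately show ?thesis
          by (simp add: lookup_sum lookup_single when_def)
      qed (simp add: in_keys_iff)
      then show "Poly_Mapping.lookup (\<beta> + (?b - \<beta>)) j = Poly_Mapping.lookup ?b j"
        by (simp add: lookup_add lookup_minus)
    qed
    then show "\<beta> \<in> fst ` splits (\<Sum>j\<in>{1..n}. Poly_Mapping.single j (deg_expo \<beta>))"
      using *(2) by (force simp: splits_def image_iff)
  qed
qed simp

lemma xdeg_eq:
  assumes "xhomogeneous f" "u \<in> monomials f"
  shows "xdeg f = ereal (mon_xdeg u)"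
proof -
  obtain d where d: "\<And>v. v \<in> monomials f \<Longrightarrow> ereal (mon_xdeg v) = ereal d"
    using assms(1) by (force simp: xhomogeneous_def xhomogeneous_of_def)
  have "xdeg f = (SUP v\<in>monomials f. ereal d)"
    unfolding xdeg_def by (rule SUP_cong) (auto simp: d)
  also have "\<dots> = ereal d" using assms(2) by (subst SUP_const) auto
  finally show ?thesis using d[OF assms(2)] by simp
qed

lemma xdeg_vmon_elt: "xdeg (vmon_elt u :: 'a::comm_ring_1 rxv) = ereal (mon_xdeg u)"
  by (simp add: xdeg_def monomials_vmon_elt)

lemma xdeg_0: "xdeg 0 = -\<infinity>"
proof -
  have "monomials (0 :: 'a rxv) = {}" by (simp add: monomials_empty_iff)
  then show ?thesis by (simp add: xdeg_def bot_ereal_def)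
qed

section \<open>The ordering on the monomials of a fixed degree\<close>

text \<open>
  A monotone subsequence exists; if it is decreasing, then, the values being natural numbers, it
  is constant from the place where it attains its minimum.
\<close>

lemma nondecreasing_subsequence:
  fixes a :: "nat \<Rightarrow> nat"
  obtains \<phi> where "strict_mono \<phi>" "incseq (a \<circ> \<phi>)"
proof -
  obtain \<psi> where \<psi>: "strict_mono \<psi>" "monoseq (\<lambda>k. a (\<psi> k))"
    using seq_monosub[of a] by blast
  show thesis
  proof (cases "incseq (\<lambda>k. a (\<psi> k))")
    case True
    with \<psi> that show thesis by (simp add: o_def)
  next
    case False
    with \<psi> have dec: "decseq (\<lambda>k. a (\<psi> k))" by (auto simp: monoseq_iff)
    define N where "N = (ARG_MIN (\<lambda>k. a (\<psi> k)) k. True)"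
    have min: "a (\<psi> N) \<le> a (\<psi> k)" for k
      unfolding N_def by (rule arg_min_nat_le) simp
    have const: "a (\<psi> (k + N)) = a (\<psi> N)" for k
      using min[of "k + N"] decseqD[OF dec, of N "k + N"] by simp
    show thesis
    proof (rule that)
      show "strict_mono (\<lambda>k. \<psi> (k + N))"
        using \<psi>(1) by (simp add: strict_mono_def)
      show "incseq (a \<circ> (\<lambda>k. \<psi> (k + N)))"
        by (simp add: o_def const)
    qed
  qed
qed

text \<open>
  The combinatorial core of Dickson's lemma, for any finite family of \<open>nat\<close>-valued coordinate
  functions: pass to a subsequence once for each coordinate.
\<close>

lemma nondecreasing_subsequence_family:
  fixes x :: "nat \<Rightarrow> 'b" and \<F> :: "('b \<Rightarrow> nat) set"
  assumes "finite \<F>"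
  shows "\<exists>\<phi>. strict_mono \<phi> \<and> (\<forall>h\<in>\<F>. incseq (\<lambda>k. h (x (\<phi> k))))"
  using assms
proof (induction \<F>)
  case empty
  show ?case by (auto intro!: exI[of _ id] simp: strict_mono_def)
next
  case (insert h \<F>)
  then obtain \<phi> where \<phi>: "strict_mono \<phi>" "\<forall>h\<in>\<F>. incseq (\<lambda>k. h (x (\<phi> k)))"
    by blast
  obtain \<psi> where \<psi>: "strict_mono \<psi>" "incseq ((\<lambda>k. h (x (\<phi> k))) \<circ> \<psi>)"
    by (rule nondecreasing_subsequence)
  have "incseq (\<lambda>k. h' (x (\<phi> (\<psi> k))))" if "h' \<in> insert h \<F>" for h'
    using that \<phi>(2) \<psi> by (fastforce simp: incseq_def o_def strict_mono_less_eq)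
  then show ?case
    using strict_mono_o[OF \<phi>(1) \<psi>(1)] by (auto simp: o_def)
qed

lemma total_ordering_onD:
  assumes "total_ordering_on S gt"
  shows "u \<in> S \<Longrightarrow> \<not> gt u u"
    and "u \<in> S \<Longrightarrow> v \<in> S \<Longrightarrow> w \<in> S \<Longrightarrow> gt u v \<Longrightarrow> gt v w \<Longrightarrow> gt u w"
    and "u \<in> S \<Longrightarrow> v \<in> S \<Longrightarrow> u \<noteq> v \<Longrightarrow> gt u v \<or> gt v u"
  using assms unfolding total_ordering_on_def
  by (auto dest: irreflp_onD transp_onD totalp_onD)

text \<open>
  If \<open>t\<^sup>\<alpha> = t\<^sup>\<alpha>' t\<^sub>i\<close>, then multiplying \<open>1 > t\<^sub>i\<close> by \<open>t\<^sup>\<alpha>'\<close> gives \<open>t\<^sup>\<alpha>' > t\<^sup>\<alpha>\<close>, and by induction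
  \<open>1 \<ge> t\<^sup>\<alpha>'\<close>.
\<close>

lemma t_monomial_less_one:
  assumes ord: "monomial_ordering m n gt'" and loc: "\<forall>i\<in>{1..m}. gt' 0 (t_var i)"
    and "Poly_Mapping.keys \<alpha> \<subseteq> {1..m}" "\<alpha> \<noteq> 0"
  shows "gt' 0 (\<alpha>, 0)"
  using assms(3,4)
proof (induction "deg_expo \<alpha>" arbitrary: \<alpha> rule: less_induct)
  case less
  have Mon0: "(0 :: mon) \<in> Mon m n" by (simp add: Mon_def zero_prod_def)
  obtain i where i: "i \<in> Poly_Mapping.keys \<alpha>"
    using less.prems(2) by (metis in_keys_iff lookup_zero poly_mapping_eqI)
  define \<alpha>' where "\<alpha>' = \<alpha> - Poly_Mapping.single i 1"
  have \<alpha>: "\<alpha> = \<alpha>' + Poly_Mapping.single i 1"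
  proof (rule poly_mapping_eqI)
    fix j
    show "Poly_Mapping.lookup \<alpha> j = Poly_Mapping.lookup (\<alpha>' + Poly_Mapping.single i 1) j"
      using i unfolding \<alpha>'_def lookup_add lookup_minus
      by (cases "j = i") (auto simp: lookup_single when_def in_keys_iff)
  qed
  have im: "i \<in> {1..m}" using i less.prems by auto
  have deg: "deg_expo \<alpha>' < deg_expo \<alpha>"
    unfolding \<alpha> deg_expo_add by (simp add: deg_expo_def)
  have keys: "Poly_Mapping.keys \<alpha>' \<subseteq> {1..m}"
    using less.prems(1) unfolding \<alpha> keys_expo_add by auto
  have M: "(\<alpha>', 0) \<in> Mon m n" "t_var i \<in> Mon m n" "(\<alpha>, 0) \<in> Mon m n"
    using keys less.prems im by (auto simp: Mon_def t_var_def)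
  have "gt' ((\<alpha>', 0) + 0) ((\<alpha>', 0) + t_var i)"
    using ord M Mon0 loc im unfolding monomial_ordering_def by blast
  then have step: "gt' (\<alpha>', 0) (\<alpha>, 0)"
    by (simp add: t_var_def \<alpha>)
  show ?case
  proof (cases "\<alpha>' = 0")
    case True
    with step show ?thesis by (simp add: zero_prod_def)
  next
    case False
    then have "gt' 0 (\<alpha>', 0)" by (rule less.hyps[OF deg keys])
    moreover have "total_ordering_on (Mon m n) gt'"
      using ord by (simp add: monomial_ordering_def)
    ultimately show ?thesis
      using total_ordering_onD(2)[of _ gt', OF _ Mon0 M(1) M(3) _ step] by blast
  qed
qed

lemma t_multiple_not_greater:
  assumes ord: "vmonomial_ordering m n s gt" and loc: "t_local m n s gt"
    and u: "((\<alpha>, \<beta>), i) \<in> VMon m n s" and v: "((\<alpha>', \<beta>), i) \<in> VMon m n s"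
    and le: "\<And>j. Poly_Mapping.lookup \<alpha> j \<le> Poly_Mapping.lookup \<alpha>' j"
  shows "\<not> gt ((\<alpha>', \<beta>), i) ((\<alpha>, \<beta>), i)"
proof
  assume gt: "gt ((\<alpha>', \<beta>), i) ((\<alpha>, \<beta>), i)"
  have tot: "total_ordering_on (VMon m n s) gt"
    using ord by (simp add: vmonomial_ordering_def)
  obtain gt' where ind: "induced_ordering m n s gt gt'" and loc': "\<forall>i\<in>{1..m}. gt' 0 (t_var i)"
    using loc by (auto simp: t_local_def)
  have mo: "monomial_ordering m n gt'"
    using ind by (simp add: induced_ordering_def)
  define \<delta> where "\<delta> = \<alpha>' - \<alpha>"
  have \<alpha>': "\<alpha>' = \<alpha> + \<delta>"
    using le by (intro poly_mapping_eqI) (simp add: \<delta>_def lookup_add lookup_minus)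
  have "\<delta> \<noteq> 0"
    using gt total_ordering_onD(1)[OF tot u] \<alpha>' by auto
  moreover have keys: "Poly_Mapping.keys \<delta> \<subseteq> {1..m}"
    using v by (auto simp: VMon_def Mon_def \<alpha>' keys_expo_add)
  ultimately have "gt' 0 (\<delta>, 0)"
    using t_monomial_less_one mo loc' by blast
  moreover have M: "(\<alpha>, \<beta>) \<in> Mon m n" "(0 :: mon) \<in> Mon m n" "(\<delta>, 0) \<in> Mon m n" "i \<in> {1..s}"
      "(\<alpha>', \<beta>) \<in> Mon m n"
    using u v keys by (auto simp: VMon_def Mon_def zero_prod_def)
  ultimately have "gt' ((\<alpha>, \<beta>) + 0) ((\<alpha>, \<beta>) + (\<delta>, 0))"
    using mo unfolding monomial_ordering_def by blast
  then have "gt' (\<alpha>, \<beta>) (\<alpha>', \<beta>)" by (simp add: \<alpha>')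
  then have "gt ((\<alpha>, \<beta>), i) ((\<alpha>', \<beta>), i)"
    using ind M unfolding induced_ordering_def by blast
  with gt show False
    using total_ordering_onD(1)[OF tot u] total_ordering_onD(2)[OF tot u v u] by blast
qed

text \<open>
  The degree is an extended real because it will be that of the dividend: for the dividend \<open>0\<close> it
  is \<open>-\<infinity>\<close> and the piece is empty, which makes all quotients and the remainder vanish.
\<close>

definition graded_piece :: "nat \<Rightarrow> nat \<Rightarrow> nat \<Rightarrow> ereal \<Rightarrow> vmon set"
  where "graded_piece m n s e = {u \<in> VMon m n s. ereal (mon_xdeg u) = e}"

text \<open>
  Fixing the \<open>x\<close>-degree is what makes \<open>t\<close>-locality sufficient for this. Along an infinite ascending
  chain, choose a subsequence on which every \<open>t\<close>-exponent, every \<open>x\<close>-exponent, the component \<open>i\<close> and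
  also \<open>s - i\<close> are nondecreasing. Then \<open>i\<close> is constant, and so is \<open>x\<^sup>\<beta>\<close>, because its degree
  is. A later member of the subsequence is therefore a \<open>t\<close>-multiple of an earlier one, and cannot be greater.
\<close>

lemma wf_graded_piece:
  assumes ord: "vmonomial_ordering m n s gt" and loc: "t_local m n s gt"
  shows "wf {(u, v). u \<in> graded_piece m n s e \<and> v \<in> graded_piece m n s e \<and> gt u v}"
  unfolding wf_iff_no_infinite_down_chain
proof
  let ?D = "graded_piece m n s e"
  assume "\<exists>x. \<forall>k. (x (Suc k), x k) \<in> {(u, v). u \<in> ?D \<and> v \<in> ?D \<and> gt u v}"
  then obtain x where x: "\<And>k. x k \<in> ?D" and gt: "\<And>k. gt (x (Suc k)) (x k)"
    by blast
  have xV: "x k \<in> VMon m n s" for k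
    using x by (simp add: graded_piece_def)
  have tot: "total_ordering_on (VMon m n s) gt"
    using ord by (simp add: vmonomial_ordering_def)
  have chain: "gt (x l) (x k)" if "k < l" for k l
    using that
  proof (induction rule: strict_inc_induct[where i = k and j = l, consumes 1])
    case (base i) then show ?case using gt by blast
  next
    case (step i) 
    then show ?case using gt[of i] total_ordering_onD(2)[OF tot xV xV xV] by blast
  qed
  define \<F> :: "(vmon \<Rightarrow> nat) set" where
    "\<F> = (\<lambda>j u. Poly_Mapping.lookup (fst (fst u)) j) ` {1..m} \<union>
         (\<lambda>j u. Poly_Mapping.lookup (snd (fst u)) j) ` {1..n} \<union> {snd, \<lambda>u. s - snd u}"
  have "finite \<F>" by (simp add: \<F>_def)
  then obtain \<phi> where \<phi>: "strict_mono \<phi>" and inc: "\<And>h. h \<in> \<F> \<Longrightarrow> incseq (\<lambda>k. h (x (\<phi> k)))"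
    using nondecreasing_subsequence_family[of \<F> x] by blast
  have le: "h (x (\<phi> 0)) \<le> h (x (\<phi> (Suc 0)))" if "h \<in> \<F>" for h
    using incseqD[OF inc[OF that], of 0 "Suc 0"] by simp
  obtain \<alpha> \<beta> i where u: "x (\<phi> 0) = ((\<alpha>, \<beta>), i)" by (metis surj_pair)
  obtain \<alpha>' \<beta>' i' where v: "x (\<phi> (Suc 0)) = ((\<alpha>', \<beta>'), i')" by (metis surj_pair)
  have uv: "((\<alpha>, \<beta>), i) \<in> ?D" "((\<alpha>', \<beta>'), i') \<in> ?D"
    using x[of "\<phi> 0"] x[of "\<phi> (Suc 0)"] by (simp_all add: u v)
  have "i' = i"
    using le[of snd] le[of "\<lambda>u. s - snd u"] uv
    by (auto simp: u v \<F>_def graded_piece_def VMon_def)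
  have le\<alpha>: "Poly_Mapping.lookup \<alpha> j \<le> Poly_Mapping.lookup \<alpha>' j" for j
  proof (cases "j \<in> {1..m}")
    case True
    then show ?thesis
      using le[of "\<lambda>u. Poly_Mapping.lookup (fst (fst u)) j"] by (auto simp: u v \<F>_def)
  next
    case False
    then have "j \<notin> Poly_Mapping.keys \<alpha>"
      using uv by (auto simp: graded_piece_def VMon_def Mon_def)
    then show ?thesis
      by (simp add: in_keys_iff)
  qed
  have le\<beta>: "Poly_Mapping.lookup \<beta> j \<le> Poly_Mapping.lookup \<beta>' j" for j
  proof (cases "j \<in> {1..n}")
    case True
    then show ?thesis
      using le[of "\<lambda>u. Poly_Mapping.lookup (snd (fst u)) j"] by (auto simp: u v \<F>_def)
  next
    case False
    then have "j \<notin> Poly_Mapping.keys \<beta>"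
      using uv by (auto simp: graded_piece_def VMon_def Mon_def)
    then show ?thesis
      by (simp add: in_keys_iff)
  qed
  define \<gamma> where "\<gamma> = \<beta>' - \<beta>"
  have \<beta>': "\<beta>' = \<beta> + \<gamma>"
    using le\<beta> by (intro poly_mapping_eqI) (simp add: \<gamma>_def lookup_add lookup_minus)
  have "deg_expo \<beta> = deg_expo \<beta>'"
    using uv by (auto simp: graded_piece_def mon_xdeg_eq)
  then have "deg_expo \<gamma> = 0" by (simp add: \<beta>' deg_expo_add)
  then have "\<gamma> = 0"
    by (intro poly_mapping_eqI) (auto simp: deg_expo_def in_keys_iff)
  then have "\<beta>' = \<beta>" by (simp add: \<beta>')
  have "\<not> gt ((\<alpha>', \<beta>), i) ((\<alpha>, \<beta>), i)"
    using uv le\<alpha> unfolding \<open>i' = i\<close> \<open>\<beta>' = \<beta>\<close> graded_piece_def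
    by (intro t_multiple_not_greater[OF ord loc]) auto
  moreover have "gt (x (\<phi> (Suc 0))) (x (\<phi> 0))"
    using chain \<phi> by (simp add: strict_mono_less)
  ultimately show False by (simp add: u v \<open>i' = i\<close> \<open>\<beta>' = \<beta>\<close>)
qed

text \<open>
  The monomials of a homogeneous element lie in one graded piece, where every nonempty set has a
  greatest element.
\<close>

lemma leading_monomial_exists:
  assumes ord: "vmonomial_ordering m n s gt" and loc: "t_local m n s gt"
    and f: "f \<in> free_module m n s" "xhomogeneous f" "f \<noteq> 0"
  obtains w where "lm gt f = vmon_elt w" "w \<in> monomials f"
    "\<And>v. v \<in> monomials f \<Longrightarrow> v \<noteq> w \<Longrightarrow> gt w v"
proof -
  have tot: "total_ordering_on (VMon m n s) gt"
    using ord by (simp add: vmonomial_ordering_def)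
  have V: "monomials f \<subseteq> VMon m n s" using f by (simp add: free_module_iff)
  then have D: "monomials f \<subseteq> graded_piece m n s (xdeg f)"
    using xdeg_eq[OF f(2)] by (auto simp: graded_piece_def)
  obtain u where "u \<in> monomials f" using f(3) monomials_empty_iff by blast
  from wfE_min[OF wf_graded_piece[OF ord loc, of "xdeg f"] this]
  obtain w where w: "w \<in> monomials f" and
    "\<And>v. (v, w) \<in> {(u, v). u \<in> graded_piece m n s (xdeg f) \<and> v \<in> graded_piece m n s (xdeg f) \<and> gt u v}
       \<Longrightarrow> v \<notin> monomials f"
    by blast
  then have max: "gt w v" if "v \<in> monomials f" "v \<noteq> w" for v
    using that D V total_ordering_onD(3)[OF tot, of v w] by blast
  have "(THE u. u \<in> monomials f \<and> (\<forall>v\<in>monomials f. v \<noteq> u \<longrightarrow> gt u v)) = w"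
  proof (rule the_equality)
    show "w \<in> monomials f \<and> (\<forall>v\<in>monomials f. v \<noteq> w \<longrightarrow> gt w v)"
      using w max by blast
    show "u = w" if "u \<in> monomials f \<and> (\<forall>v\<in>monomials f. v \<noteq> u \<longrightarrow> gt u v)" for u
      using that w max V total_ordering_onD(1,2)[OF tot] by (metis subsetD)
  qed
  then have "lm gt f = vmon_elt w"
    using f(3) by (simp add: lm_def)
  with w max that show thesis by blast
qed



section \<open>Division as a triangular system of linear equations\<close>

lemma sum_fun_apply: "(\<Sum>i\<in>S. h i) x = (\<Sum>i\<in>S. h i x)" for h :: "_ \<Rightarrow> _ \<Rightarrow> 'b::comm_monoid_add"
  by (induction S rule: infinite_finite_induct) auto

text \<open>
  The divisors \<open>g i\<close>, \<open>i \<in> I\<close>, are the nonzero ones, and \<open>w i\<close> is the leading monomial of \<open>g i\<close>.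
  The degree \<open>e\<close> is that of the dividend.
\<close>

locale homogeneous_division =
  fixes m n s :: nat and gt :: "vmon \<Rightarrow> vmon \<Rightarrow> bool" and e :: ereal
    and I :: "nat set" and g :: "nat \<Rightarrow> 'k::field rxv" and w :: "nat \<Rightarrow> vmon"
  assumes ordering: "vmonomial_ordering m n s gt"
    and local_ordering: "t_local m n s gt"
    and finite_I: "finite I"
    and g_in: "\<And>i. i \<in> I \<Longrightarrow> monomials (g i) \<subseteq> VMon m n s"
    and g_homogeneous: "\<And>i u. i \<in> I \<Longrightarrow> u \<in> monomials (g i) \<Longrightarrow> mon_xdeg u = mon_xdeg (w i)"
    and w_in: "\<And>i. i \<in> I \<Longrightarrow> w i \<in> monomials (g i)"
    and w_greatest: "\<And>i u. i \<in> I \<Longrightarrow> u \<in> monomials (g i) \<Longrightarrow> u \<noteq> w i \<Longrightarrow> gt (w i) u"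
begin

abbreviation D :: "vmon set"
  where "D \<equiv> graded_piece m n s e"

definition lead_multiple :: "nat \<Rightarrow> mon \<Rightarrow> vmon"
  where "lead_multiple i a = (a + fst (w i), snd (w i))"

definition least_divisor :: "nat \<Rightarrow> vmon \<Rightarrow> bool"
  where "least_divisor i v \<longleftrightarrow> i \<in> I \<and> vmon_dvd m n (w i) v \<and> (\<forall>j\<in>I. j < i \<longrightarrow> \<not> vmon_dvd m n (w j) v)"

definition lead_coeff_of :: "nat \<Rightarrow> 'k"
  where "lead_coeff_of i = coeff_at (g i (snd (w i))) (fst (w i))"

text \<open>
  A function \<open>c\<close> on the monomials of degree \<open>e\<close> is read as the coefficients of
  \<open>\<Sum>i. q\<^sub>i \<cdot> lt(g\<^sub>i) + r\<close>, where \<open>lt\<close> denotes the leading term. The next definitions recover the \<open>q\<^sub>i\<close>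
  and \<open>r\<close> from it: the value \<open>c v\<close> belongs to the least \<open>i\<close> whose leading monomial divides
  \<open>v\<close>, and to the remainder if there is none.
\<close>

definition quot_coeff :: "(vmon \<Rightarrow> 'k) \<Rightarrow> nat \<Rightarrow> mon \<Rightarrow> 'k"
  where "quot_coeff c i a = (if least_divisor i (lead_multiple i a) then c (lead_multiple i a) / lead_coeff_of i else 0)"

definition quotients :: "(vmon \<Rightarrow> 'k) \<Rightarrow> nat \<Rightarrow> 'k rx"
  where "quotients c i = rx_of_coeffs (quot_coeff c i)"

definition remainder_coeff :: "(vmon \<Rightarrow> 'k) \<Rightarrow> vmon \<Rightarrow> 'k"
  where "remainder_coeff c v = (if \<exists>i. least_divisor i v then 0 else c v)"

definition remainder :: "(vmon \<Rightarrow> 'k) \<Rightarrow> 'k rxv"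
  where "remainder c j = rx_of_coeffs (\<lambda>a. remainder_coeff c (a, j))"

definition supported :: "(vmon \<Rightarrow> 'k) \<Rightarrow> bool"
  where "supported c \<longleftrightarrow> (\<forall>v. c v \<noteq> 0 \<longrightarrow> v \<in> D)"

text \<open>
  The three conditions on quotients and remainder, in terms of exponents: those on the quotients
  by nonzero divisors and on the remainder. That \<open>w i\<close> itself divides \<open>lead_multiple i a\<close> is built
  into \<open>least_divisor\<close>; it holds for every \<open>a\<close> in \<open>Mon m n\<close>.
\<close>

definition admissible :: "(nat \<Rightarrow> 'k rx) \<Rightarrow> 'k rxv \<Rightarrow> bool"
  where "admissible q r \<longleftrightarrow>
    (\<forall>i\<in>I. \<forall>a. coeff_at (q i) a \<noteq> 0 \<longrightarrow> lead_multiple i a \<in> D \<and> least_divisor i (lead_multiple i a)) \<and>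
    (\<forall>v\<in>monomials r. v \<in> D \<and> (\<forall>i\<in>I. \<not> vmon_dvd m n (w i) v))"

text \<open>
  The contribution to the coefficient at \<open>v\<close> of those multiples of the divisors whose leading
  monomial is greater than \<open>v\<close>; by definition it depends only on values of \<open>c\<close> at monomials
  greater than \<open>v\<close>.
\<close>

definition tail_sum :: "(vmon \<Rightarrow> 'k) \<Rightarrow> vmon \<Rightarrow> 'k"
  where "tail_sum c v = (\<Sum>i\<in>I. \<Sum>(a, b)\<in>mon_splits (fst v).
     if lead_multiple i a \<in> D \<and> gt (lead_multiple i a) v then quot_coeff c i a * coeff_at (g i (snd v)) b else 0)"

lemma supportedD: "supported c \<Longrightarrow> c v \<noteq> 0 \<Longrightarrow> v \<in> D"
  unfolding supported_def by blast

lemma quot_coeff_nonzeroD: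
  "supported c \<Longrightarrow> quot_coeff c i a \<noteq> 0 \<Longrightarrow> lead_multiple i a \<in> D \<and> least_divisor i (lead_multiple i a)"
  by (metis div_0 quot_coeff_def supportedD)

lemma remainder_coeff_nonzeroD:
  "supported c \<Longrightarrow> remainder_coeff c v \<noteq> 0 \<Longrightarrow> v \<in> D \<and> \<not> (\<exists>i. least_divisor i v)"
  by (metis remainder_coeff_def supportedD)

lemma admissibleD:
  assumes "admissible q r"
  shows "i \<in> I \<Longrightarrow> coeff_at (q i) a \<noteq> 0 \<Longrightarrow> lead_multiple i a \<in> D"
    and "i \<in> I \<Longrightarrow> coeff_at (q i) a \<noteq> 0 \<Longrightarrow> least_divisor i (lead_multiple i a)"
    and "v \<in> monomials r \<Longrightarrow> v \<in> D"
    and "v \<in> monomials r \<Longrightarrow> i \<in> I \<Longrightarrow> \<not> vmon_dvd m n (w i) v"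
  using assms unfolding admissible_def by blast+

lemma lead_coeff_nonzero: "i \<in> I \<Longrightarrow> lead_coeff_of i \<noteq> 0"
  using w_in by (simp add: lead_coeff_of_def monomials_iff)

lemma total: "total_ordering_on (VMon m n s) gt"
  using ordering by (simp add: vmonomial_ordering_def)

lemma least_divisor_unique: "least_divisor i v \<Longrightarrow> least_divisor j v \<Longrightarrow> i = j"
  unfolding least_divisor_def by (metis linorder_neqE_nat)

lemma least_divisor_exists_iff: "(\<exists>i. least_divisor i v) \<longleftrightarrow> (\<exists>i\<in>I. vmon_dvd m n (w i) v)"
proof
  assume "\<exists>i\<in>I. vmon_dvd m n (w i) v"
  then have *: "\<exists>i. i \<in> I \<and> vmon_dvd m n (w i) v" by blast
  have "least_divisor (LEAST i. i \<in> I \<and> vmon_dvd m n (w i) v) v"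
    unfolding least_divisor_def using LeastI_ex[OF *] not_less_Least by blast
  then show "\<exists>i. least_divisor i v" ..
qed (auto simp: least_divisor_def)

lemma lead_multiple_in_D:
  assumes "i \<in> I"
  shows "lead_multiple i a \<in> D \<longleftrightarrow> a \<in> Mon m n \<and> ereal (mon_xdeg (a, j) + mon_xdeg (w i)) = e"
proof -
  have "w i \<in> VMon m n s" using assms g_in w_in by blast
  then have "fst (w i) \<in> Mon m n" "snd (w i) \<in> {1..s}" by (auto simp: VMon_def mem_Times_iff)
  moreover have "mon_xdeg (lead_multiple i a) = mon_xdeg (a, j) + mon_xdeg (w i)"
    unfolding lead_multiple_def by (subst mon_xdeg_add[where j = j and l = "snd (w i)"]) simp
  ultimately show ?thesis
    by (auto simp: graded_piece_def lead_multiple_def VMon_def Mon_add_iff)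
qed

lemma finite_x_exponents: "finite {\<beta>. \<exists>\<alpha> i. ((\<alpha>, \<beta>), i) \<in> D}"
proof (cases "D = {}")
  case False
  then obtain u where u: "u \<in> D" by blast
  have "{\<beta>. \<exists>\<alpha> i. ((\<alpha>, \<beta>), i) \<in> D} \<subseteq> {\<beta>. Poly_Mapping.keys \<beta> \<subseteq> {1..n} \<and> deg_expo \<beta> = mon_xdeg u}"
    using u by (auto simp: graded_piece_def VMon_def Mon_def mon_xdeg_eq)
  then show ?thesis using finite_expo_of_degree finite_subset by blast
qed simp

text \<open>
  Only finitely many \<open>x\<close>-exponents have a given degree, so a function supported on the graded piece
  does define polynomials in \<open>x\<close>.
\<close>

lemma coeff_quotients:
  assumes "i \<in> I" "supported c"
  shows "coeff_at (quotients c i) a = quot_coeff c i a"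
  unfolding quotients_def
proof (rule coeff_at_rx_of_coeffs, rule finite_subset)
  show "{\<beta>. \<exists>\<alpha>. quot_coeff c i (\<alpha>, \<beta>) \<noteq> 0} \<subseteq> (\<lambda>\<beta>. \<beta> - snd (fst (w i))) ` {\<beta>. \<exists>\<alpha> i. ((\<alpha>, \<beta>), i) \<in> D}"
  proof clarify
    fix \<alpha> \<beta> assume "quot_coeff c i (\<alpha>, \<beta>) \<noteq> 0"
    then have "lead_multiple i (\<alpha>, \<beta>) \<in> D"
      using assms quot_coeff_nonzeroD by blast
    then have "((\<alpha> + fst (fst (w i)), \<beta> + snd (fst (w i))), snd (w i)) \<in> D"
      by (cases "w i") (auto simp: lead_multiple_def plus_prod_def)
    then show "\<beta> \<in> (\<lambda>\<beta>. \<beta> - snd (fst (w i))) ` {\<beta>. \<exists>\<alpha> i. ((\<alpha>, \<beta>), i) \<in> D}"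
      by (intro image_eqI[where x = "\<beta> + snd (fst (w i))"]) auto
  qed
qed (intro finite_imageI finite_x_exponents)

lemma coeff_remainder:
  assumes "supported c"
  shows "coeff_at (remainder c j) a = remainder_coeff c (a, j)"
  unfolding remainder_def
proof (rule coeff_at_rx_of_coeffs, rule finite_subset)
  show "{\<beta>. \<exists>\<alpha>. remainder_coeff c ((\<alpha>, \<beta>), j) \<noteq> 0} \<subseteq> {\<beta>. \<exists>\<alpha> i. ((\<alpha>, \<beta>), i) \<in> D}"
    using remainder_coeff_nonzeroD[OF assms] by blast
qed (rule finite_x_exponents)

lemma decoded_admissible:
  assumes "supported c"
  shows "admissible (quotients c) (remainder c)"
  unfolding admissible_def
proof (intro conjI ballI allI impI)
  fix i a assume i: "i \<in> I" and "coeff_at (quotients c i) a \<noteq> 0"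
  then have "quot_coeff c i a \<noteq> 0" by (simp add: coeff_quotients assms)
  then show "lead_multiple i a \<in> D" "least_divisor i (lead_multiple i a)"
    using quot_coeff_nonzeroD[OF assms] by blast+
next
  fix v assume "v \<in> monomials (remainder c)"
  then have *: "remainder_coeff c v \<noteq> 0"
    by (simp add: monomials_iff coeff_remainder assms)
  then show "v \<in> D"
    using remainder_coeff_nonzeroD[OF assms] by blast
  show "\<not> vmon_dvd m n (w i) v" if "i \<in> I" for i
    using * that least_divisor_exists_iff remainder_coeff_nonzeroD[OF assms] by blast
qed

text \<open>
  An admissible pair attributes each monomial \<open>v\<close> to a single place, either to one quotient or to
  the remainder, so \<open>c v\<close> can be read off there; multiplying by the leading coefficient undoes the
  normalization in \<open>quot_coeff\<close>.
\<close>

lemma admissible_decoded: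
  assumes adm: "admissible q r"
  obtains c where "supported c" "\<And>i. i \<in> I \<Longrightarrow> q i = quotients c i" "r = remainder c"
proof
  define c where "c v = (if \<exists>i. least_divisor i v
      then let i = THE i. least_divisor i v in lead_coeff_of i * coeff_at (q i) (fst v - fst (w i))
      else coeff_at (r (snd v)) (fst v))" for v
  have c_led: "c v = lead_coeff_of i * coeff_at (q i) (fst v - fst (w i))" if "least_divisor i v" for i v
  proof -
    have "(THE i. least_divisor i v) = i"
      using that least_divisor_unique by blast
    with that show ?thesis by (auto simp: c_def)
  qed
  show sup: "supported c"
    unfolding supported_def
  proof (intro allI impI)
    fix v assume nz: "c v \<noteq> 0"
    show "v \<in> D"
    proof (cases "\<exists>i. least_divisor i v")
      case True
      then obtain i where i: "least_divisor i v" by blast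
      then obtain a where "v = lead_multiple i a" and "i \<in> I"
        unfolding least_divisor_def vmon_dvd_def lead_multiple_def by (metis prod.collapse)
      moreover from this have "coeff_at (q i) a \<noteq> 0"
        using nz c_led[OF i] by (simp add: lead_multiple_def)
      ultimately show ?thesis using admissibleD(1)[OF adm] by blast
    next
      case False
      with nz have "v \<in> monomials r" by (simp add: c_def monomials_iff)
      then show ?thesis by (rule admissibleD(3)[OF adm])
    qed
  qed
  show "q i = quotients c i" if i: "i \<in> I" for i
  proof (rule rx_eqI)
    fix a
    show "coeff_at (q i) a = coeff_at (quotients c i) a"
    proof (cases "least_divisor i (lead_multiple i a)")
      case True
      then show ?thesis
        using c_led[OF True] lead_coeff_nonzero[OF i]
        by (simp add: coeff_quotients i sup quot_coeff_def) (simp add: lead_multiple_def)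
    next
      case False
      then have "coeff_at (q i) a = 0"
        using admissibleD(2)[OF adm i] by blast
      with False show ?thesis by (simp add: coeff_quotients i sup quot_coeff_def)
    qed
  qed
  show "r = remainder c"
  proof (rule rxv_eqI)
    fix v
    show "coeff_at (r (snd v)) (fst v) = coeff_at (remainder c (snd v)) (fst v)"
    proof (cases "\<exists>i. least_divisor i v")
      case True
      then have "v \<notin> monomials r"
        using admissibleD(4)[OF adm] least_divisor_exists_iff by blast
      with True show ?thesis by (auto simp: coeff_remainder sup remainder_coeff_def monomials_iff)
    next
      case False
      then show ?thesis by (simp add: coeff_remainder sup remainder_coeff_def c_def)
    qed
  qed
qed

text \<open>
  Multiplication by a monomial preserves the ordering, so in a monomial multiple of \<open>g i\<close> the
  multiple of \<open>w i\<close> remains the greatest monomial.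
\<close>

lemma product_term_position:
  assumes i: "i \<in> I" and D: "lead_multiple i a \<in> D" and b: "coeff_at (g i (snd v)) b \<noteq> 0" and v: "a + b = fst v"
  shows "v \<in> D" "b \<noteq> fst (w i) \<or> snd v \<noteq> snd (w i) \<Longrightarrow> gt (lead_multiple i a) v"
proof -
  have bm: "(b, snd v) \<in> monomials (g i)" using b by (simp add: monomials_iff)
  have bV: "(b, snd v) \<in> VMon m n s" using bm g_in[OF i] by blast
  have wV: "w i \<in> VMon m n s" using w_in[OF i] g_in[OF i] by blast
  have a: "a \<in> Mon m n" and deg: "ereal (mon_xdeg (a, 0) + mon_xdeg (w i)) = e"
    using D lead_multiple_in_D[OF i, of a 0] by auto
  have "mon_xdeg v = mon_xdeg (a, 0) + mon_xdeg (b, snd v)"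
    by (metis mon_xdeg_add prod.collapse v)
  with deg g_homogeneous[OF i bm] have "ereal (mon_xdeg v) = e" by simp
  moreover have "v \<in> VMon m n s"
    using a bV v by (metis Mon_add_iff VMon_def mem_Times_iff fst_conv snd_conv)
  ultimately show "v \<in> D" by (simp add: graded_piece_def)
  assume "b \<noteq> fst (w i) \<or> snd v \<noteq> snd (w i)"
  then have "gt (w i) (b, snd v)"
    using w_greatest[OF i bm] by (auto simp: prod_eq_iff)
  \<comment> \<open>compatibility of the ordering is formulated for explicit pairs\<close>
  then have "gt (fst (w i), snd (w i)) (b, snd v)" by simp
  then have "gt (a + fst (w i), snd (w i)) (a + b, snd v)"
    using ordering a bV wV unfolding vmonomial_ordering_def
    by (metis (no_types, lifting) case_prodD prod.collapse)
  then show "gt (lead_multiple i a) v" by (simp add: lead_multiple_def v)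
qed

text \<open>
  Of the products of terms that meet at \<open>v\<close> and are not counted in \<open>tail_sum\<close>, only one can
  survive: the one in which the leading monomial of \<open>g i\<close> is lifted exactly to \<open>v\<close>.
\<close>

lemma leading_part:
  assumes i: "i \<in> I" and sup: "supported c" and v: "v \<in> D"
  shows "(\<Sum>(a, b)\<in>mon_splits (fst v). if lead_multiple i a \<in> D \<and> gt (lead_multiple i a) v then 0
            else quot_coeff c i a * coeff_at (g i (snd v)) b) = (if least_divisor i v then c v else 0)"
    (is "sum ?t _ = _")
proof -
  have irrefl: "\<not> gt v v" using v total_ordering_onD(1)[OF total] by (simp add: graded_piece_def)
  have zero: "?t (a, b) = 0" if "a + b = fst v" "\<not> (lead_multiple i a = v \<and> b = fst (w i))" for a b
  proof (rule ccontr)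
    assume nz: "?t (a, b) \<noteq> 0"
    then have q: "quot_coeff c i a \<noteq> 0" and b: "coeff_at (g i (snd v)) b \<noteq> 0"
      by (auto split: if_splits)
    from q have D: "lead_multiple i a \<in> D"
      using quot_coeff_nonzeroD[OF sup] by blast
    with nz have "\<not> gt (lead_multiple i a) v" by (auto split: if_splits)
    then have "b = fst (w i)" "snd v = snd (w i)"
      using product_term_position(2)[OF i D b that(1)] by auto
    with that show False by (auto simp: lead_multiple_def prod_eq_iff)
  qed
  show ?thesis
  proof (cases "least_divisor i v")
    case True
    then obtain a where a: "v = lead_multiple i a"
      unfolding least_divisor_def vmon_dvd_def lead_multiple_def by (metis prod.collapse)
    have "sum ?t (mon_splits (fst v)) = sum ?t {(a, fst (w i))}"
    proof (rule sum.mono_neutral_right)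
      show "{(a, fst (w i))} \<subseteq> mon_splits (fst v)" by (simp add: mon_splits_def a lead_multiple_def)
      show "\<forall>x\<in>mon_splits (fst v) - {(a, fst (w i))}. ?t x = 0"
      proof
        fix x assume x: "x \<in> mon_splits (fst v) - {(a, fst (w i))}"
        obtain y z where yz: "x = (y, z)" by (metis surj_pair)
        have "y = a" if "lead_multiple i y = v" using that a by (simp add: lead_multiple_def)
        with x yz show "?t x = 0" using zero[of y z] by (auto simp: mon_splits_def)
      qed
    qed simp
    also have "\<dots> = c v"
      using irrefl True lead_coeff_nonzero[OF i]
      by (simp add: a quot_coeff_def lead_coeff_of_def) (simp add: lead_multiple_def)
    finally show ?thesis using True by simp
  next
    case False
    have "?t x = 0" if "x \<in> mon_splits (fst v)" for x
    proof -
      obtain a b where x: "x = (a, b)" by (metis surj_pair)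
      show ?thesis
      proof (cases "lead_multiple i a = v")
        case True
        then show ?thesis using False by (simp add: x quot_coeff_def)
      next
        case False
        then show ?thesis using zero[of a b] that by (simp add: x mon_splits_def)
      qed
    qed
    with False show ?thesis by (simp add: sum.neutral)
  qed
qed

text \<open>
  This is the triangular shape: passing from the leading terms to the \<open>g i\<close> themselves changes
  the coefficient \<open>c v\<close> at \<open>v\<close> only by values of \<open>c\<close> at greater monomials.
\<close>

lemma coeff_decoded:
  assumes sup: "supported c"
  shows "coeff_at (((\<Sum>i\<in>I. quotients c i \<odot> g i) + remainder c) (snd v)) (fst v) =
    (if v \<in> D then c v + tail_sum c v else 0)"
proof -
  let ?p = "\<lambda>i a b. quot_coeff c i a * coeff_at (g i (snd v)) b"
  have expand: "coeff_at (((\<Sum>i\<in>I. quotients c i \<odot> g i) + remainder c) (snd v)) (fst v) =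
      (\<Sum>i\<in>I. \<Sum>(a, b)\<in>mon_splits (fst v). ?p i a b) + remainder_coeff c v"
    by (simp add: sum_fun_apply coeff_at_add coeff_at_sum scale_def coeff_at_mult coeff_quotients
        coeff_remainder sup)
  show ?thesis
  proof (cases "v \<in> D")
    case True
    have "(\<Sum>(a, b)\<in>mon_splits (fst v). ?p i a b) =
        (\<Sum>(a, b)\<in>mon_splits (fst v). if lead_multiple i a \<in> D \<and> gt (lead_multiple i a) v then ?p i a b else 0)
        + (if least_divisor i v then c v else 0)" if "i \<in> I" for i
      unfolding leading_part[OF that sup True, symmetric] sum.distrib[symmetric]
      by (rule sum.cong) auto
    then have "(\<Sum>i\<in>I. \<Sum>(a, b)\<in>mon_splits (fst v). ?p i a b) =
        tail_sum c v + (\<Sum>i\<in>I. if least_divisor i v then c v else 0)"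
      by (simp add: tail_sum_def sum.distrib)
    moreover have "(\<Sum>i\<in>I. if least_divisor i v then c v else 0) + remainder_coeff c v = c v"
    proof (cases "\<exists>i. least_divisor i v")
      case True
      then obtain i where i: "least_divisor i v" by blast
      then have "(least_divisor j v) = (j = i)" for j using least_divisor_unique by blast
      moreover have "i \<in> I" using i by (simp add: least_divisor_def)
      ultimately show ?thesis by (simp add: remainder_coeff_def finite_I)
    next
      case False
      then show ?thesis by (simp add: remainder_coeff_def)
    qed
    ultimately show ?thesis unfolding expand using True by (simp add: add.assoc add.commute)
  next
    case False
    have "?p i a b = 0" if "i \<in> I" "a + b = fst v" for i a b
    proof (rule ccontr)
      assume "?p i a b \<noteq> 0"
      then have "lead_multiple i a \<in> D" "coeff_at (g i (snd v)) b \<noteq> 0"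
        using quot_coeff_nonzeroD[OF sup, of i a] by auto
      with product_term_position(1)[OF that(1) _ _ that(2)] False show False by blast
    qed
    then have "(\<Sum>i\<in>I. \<Sum>(a, b)\<in>mon_splits (fst v). ?p i a b) = 0"
      by (intro sum.neutral ballI) (auto simp: mon_splits_def)
    moreover have "remainder_coeff c v = 0"
      using False remainder_coeff_nonzeroD[OF sup] by blast
    ultimately show ?thesis unfolding expand using False by simp
  qed
qed

text \<open>
  The equation expresses \<open>c v\<close> by the values of \<open>c\<close> at greater monomials of the same degree, so
  it is a recursion along the ordering, which is well-founded downwards. Each step is a finite
  sum, even where infinitely many monomials are greater than \<open>v\<close>.
\<close>

lemma unique_solution:
  "\<exists>!c. \<forall>v. c v = (if v \<in> D then h v - tail_sum c v else 0)"
proof -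
  define R where "R = {(u, v). u \<in> D \<and> v \<in> D \<and> gt u v}"
  define F where "F c v = (if v \<in> D then h v - tail_sum c v else 0)" for c v
  have wf: "wf R"
    unfolding R_def by (rule wf_graded_piece[OF ordering local_ordering])
  have tail_cong: "tail_sum c v = tail_sum c' v"
    if "v \<in> D" "\<And>u. (u, v) \<in> R \<Longrightarrow> c u = c' u" for c c' v
  proof -
    have "quot_coeff c i a = quot_coeff c' i a" if "lead_multiple i a \<in> D \<and> gt (lead_multiple i a) v" for i a
      using that \<open>v \<in> D\<close> \<open>\<And>u. (u, v) \<in> R \<Longrightarrow> c u = c' u\<close> by (simp add: quot_coeff_def R_def)
    then show ?thesis
      unfolding tail_sum_def by (intro sum.cong refl) (simp add: case_prod_beta cong: if_cong)
  qed
  have adm: "adm_wf R F"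
    unfolding adm_wf_def
  proof (intro allI impI)
    fix c c' :: "vmon \<Rightarrow> 'k" and v assume "\<forall>u. (u, v) \<in> R \<longrightarrow> c u = c' u"
    then have "tail_sum c v = tail_sum c' v" if "v \<in> D" using tail_cong[OF that] by blast
    then show "F c v = F c' v" by (simp add: F_def)
  qed
  have solution: "\<forall>v. wfrec R F v = F (wfrec R F) v"
    using wfrec_fixpoint[OF wf adm] by metis
  have unique: "c v = c' v" if "\<forall>v. c v = F c v" "\<forall>v. c' v = F c' v" for c c' v
    using wf
  proof (induction v rule: wf_induct_rule)
    case (less v)
    have "tail_sum c v = tail_sum c' v" if "v \<in> D" using tail_cong[OF that] less by blast
    then have "F c v = F c' v" by (simp add: F_def)
    then show ?case using that by metis
  qed
  have "\<exists>!c. \<forall>v. c v = F c v"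
  proof (rule ex1I)
    show "\<forall>v. wfrec R F v = F (wfrec R F) v" by (rule solution)
    show "c = wfrec R F" if "\<forall>v. c v = F c v" for c
      using unique[OF that solution] by (rule ext)
  qed
  then show ?thesis unfolding F_def .
qed

lemma division_exists_unique:
  assumes "monomials f \<subseteq> D"
  obtains q\<^sub>0 r\<^sub>0 where "admissible q\<^sub>0 r\<^sub>0" "f = (\<Sum>i\<in>I. q\<^sub>0 i \<odot> g i) + r\<^sub>0"
    "\<And>q r. admissible q r \<Longrightarrow> f = (\<Sum>i\<in>I. q i \<odot> g i) + r \<Longrightarrow> (\<forall>i\<in>I. q i = q\<^sub>0 i) \<and> r = r\<^sub>0"
proof -
  let ?h = "\<lambda>v. coeff_at (f (snd v)) (fst v)"
  let ?fix = "\<lambda>c. \<forall>v. c v = (if v \<in> D then ?h v - tail_sum c v else 0)"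
  have fix_iff: "f = (\<Sum>i\<in>I. quotients c i \<odot> g i) + remainder c \<longleftrightarrow> ?fix c" if sup: "supported c" for c
  proof -
    have "f = (\<Sum>i\<in>I. quotients c i \<odot> g i) + remainder c \<longleftrightarrow>
        (\<forall>v. ?h v = (if v \<in> D then c v + tail_sum c v else 0))"
      (is "f = ?t \<longleftrightarrow> ?R")
    proof
      assume eq: "f = ?t"
      show ?R unfolding coeff_decoded[OF sup, symmetric] eq[symmetric] by simp
    next
      assume R: ?R
      show "f = ?t" by (rule rxv_eqI) (simp only: coeff_decoded[OF sup] R)
    qed
    also have "\<dots> \<longleftrightarrow> ?fix c"
    proof -
      have "?h v = (if v \<in> D then c v + tail_sum c v else 0) \<longleftrightarrow>
          c v = (if v \<in> D then ?h v - tail_sum c v else 0)" for v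
      proof (cases "v \<in> D")
        case False
        then have "?h v = 0" using assms by (auto simp: monomials_iff)
        moreover have "c v = 0" using False supportedD[OF sup] by blast
        ultimately show ?thesis using False by simp
      qed (auto simp: algebra_simps)
      then show ?thesis by simp
    qed
    finally show ?thesis .
  qed
  have fix_supported: "supported c" if "?fix c" for c
    unfolding supported_def using that by metis
  obtain c\<^sub>0 where c0: "?fix c\<^sub>0" and c0_unique: "\<And>c. ?fix c \<Longrightarrow> c = c\<^sub>0"
    using unique_solution[of ?h] by (elim ex1E) blast
  show thesis
  proof (rule that)
    show "admissible (quotients c\<^sub>0) (remainder c\<^sub>0)"
      by (rule decoded_admissible[OF fix_supported[OF c0]])
    show "f = (\<Sum>i\<in>I. quotients c\<^sub>0 i \<odot> g i) + remainder c\<^sub>0"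
      using fix_iff[OF fix_supported[OF c0]] c0 by blast
    fix q r assume adm: "admissible q r" and f: "f = (\<Sum>i\<in>I. q i \<odot> g i) + r"
    obtain c where c: "supported c" "\<And>i. i \<in> I \<Longrightarrow> q i = quotients c i" "r = remainder c"
      using admissible_decoded[OF adm] by blast
    have "f = (\<Sum>i\<in>I. quotients c i \<odot> g i) + remainder c"
      unfolding f using c by simp
    then have "c = c\<^sub>0" using fix_iff[OF c(1)] c0_unique by blast
    with c show "(\<forall>i\<in>I. q i = quotients c\<^sub>0 i) \<and> r = remainder c\<^sub>0" by simp
  qed
qed

end

lemma ereal_eq_diff_iff: "ereal x = e - ereal y \<longleftrightarrow> ereal (x + y) = e"
  by (cases e) auto

section \<open>Division with remainder\<close>

theorem theorem2p1:
  fixes m n s k :: nat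
    and gt :: "vmon \<Rightarrow> vmon \<Rightarrow> bool"
    and f :: "'k::field rxv"
    and g :: "nat \<Rightarrow> 'k rxv"
  assumes "s \<ge> 1"
    and "vmonomial_ordering m n s gt"
    and "t_local m n s gt"
    and "f \<in> free_module m n s" and "xhomogeneous f"
    and "\<forall>i\<in>{1..k}. g i \<in> free_module m n s \<and> xhomogeneous (g i)"
  shows "\<exists>!(q, r).
      q \<in> {1..k} \<rightarrow>\<^sub>E poly_ring m n \<and> r \<in> free_module m n s \<and>
      f = (\<Sum>i\<in>{1..k}. q i \<odot> g i) + r \<and>
      (\<forall>i\<in>{1..k}. \<forall>j\<in>{1..k}. j < i \<longrightarrow>
         no_term_divisible m n (q i \<odot> lm gt (g i)) (lm gt (g j))) \<and>
      (\<forall>i\<in>{1..k}. no_term_divisible m n r (lm gt (g i))) \<and>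
      (\<forall>i\<in>{1..k}. poly_xhomogeneous_of (xdeg f - xdeg (lm gt (g i))) (q i)) \<and>
      xhomogeneous_of (xdeg f) r"
    (is "\<exists>!(q, r). ?P q r")
proof -
  let ?e = "xdeg f"
  define I where "I = {i \<in> {1..k}. g i \<noteq> 0}"
  have "\<forall>i\<in>I. \<exists>w. lm gt (g i) = vmon_elt w \<and> w \<in> monomials (g i) \<and>
      (\<forall>v\<in>monomials (g i). v \<noteq> w \<longrightarrow> gt w v)"
  proof
    fix i assume "i \<in> I"
    then have "g i \<in> free_module m n s" "xhomogeneous (g i)" "g i \<noteq> 0"
      using assms(6) by (auto simp: I_def)
    from leading_monomial_exists[OF assms(2,3) this]
    show "\<exists>w. lm gt (g i) = vmon_elt w \<and> w \<in> monomials (g i) \<and>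
      (\<forall>v\<in>monomials (g i). v \<noteq> w \<longrightarrow> gt w v)" by metis
  qed
  then obtain w where w: "\<And>i. i \<in> I \<Longrightarrow> lm gt (g i) = vmon_elt (w i)"
      "\<And>i. i \<in> I \<Longrightarrow> w i \<in> monomials (g i)"
      "\<And>i v. i \<in> I \<Longrightarrow> v \<in> monomials (g i) \<Longrightarrow> v \<noteq> w i \<Longrightarrow> gt (w i) v"
    by (metis bchoice)
  interpret homogeneous_division m n s gt ?e I g w
  proof
    show "vmonomial_ordering m n s gt" "t_local m n s gt" "finite I"
      using assms by (auto simp: I_def)
    show "monomials (g i) \<subseteq> VMon m n s" if "i \<in> I" for i
      using that assms(6) by (auto simp: I_def free_module_iff)
    show "mon_xdeg u = mon_xdeg (w i)" if "i \<in> I" "u \<in> monomials (g i)" for i u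
    proof -
      have "xhomogeneous (g i)" using that assms(6) by (auto simp: I_def)
      then show ?thesis using xdeg_eq that w(2) by (metis ereal.inject of_nat_eq_iff)
    qed
  qed (use w in auto)
  have lm0: "lm gt (g i) = 0" if "i \<in> {1..k}" "i \<notin> I" for i
    using that by (simp add: I_def lm_def)
  \<comment> \<open>The prescribed degree of the quotient by \<open>g i = 0\<close> is \<open>\<infinity>\<close>, which forces it to vanish.\<close>
  have zero_homogeneous: "poly_xhomogeneous_of (?e - xdeg (lm gt (g i))) p \<longleftrightarrow> p = 0"
    if "i \<in> {1..k}" "i \<notin> I" for i p
  proof -
    have "?e - xdeg (lm gt (g i)) = \<infinity>" by (cases ?e) (simp_all add: lm0[OF that] xdeg_0)
    then show ?thesis
      by (auto simp: poly_xhomogeneous_of_def xhomogeneous_of_def monomials_scale_unit_vec intro!: rx_eqI)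
  qed
  have f_in: "monomials f \<subseteq> D"
    using assms(4) xdeg_eq[OF assms(5)] by (auto simp: free_module_iff graded_piece_def)
  \<comment> \<open>On the indices of nonzero divisors the required conditions amount to admissibility.\<close>
  have P_iff: "?P q r \<longleftrightarrow> (\<forall>i. i \<notin> {1..k} \<longrightarrow> q i = undefined) \<and> (\<forall>i\<in>{1..k}. i \<notin> I \<longrightarrow> q i = 0) \<and>
      admissible q r \<and> f = (\<Sum>i\<in>I. q i \<odot> g i) + r" for q r
  proof -
    have I_sub: "I \<subseteq> {1..k}" by (auto simp: I_def)
    have sum_I: "(\<Sum>i\<in>{1..k}. q i \<odot> g i) = (\<Sum>i\<in>I. q i \<odot> g i)"
      by (rule sum.mono_neutral_right) (auto simp: I_def scale_def zero_fun_def)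
    have dvd0: "no_term_divisible m n h (lm gt (g j))" if "j \<in> {1..k}" "j \<notin> I" for h :: "'k rxv" and j
      using that by (simp add: lm0 no_term_divisible_def not_mon_dvd_zero)
    have no_term0: "no_term_divisible m n (q i \<odot> lm gt (g i)) p" if "i \<in> {1..k}" "i \<notin> I" for i p
    proof -
      have "q i \<odot> lm gt (g i) = 0" using that by (simp add: lm0 scale_def zero_fun_def)
      then have "monomials (q i \<odot> lm gt (g i)) = {}" by (simp add: monomials_empty_iff)
      then show ?thesis by (simp add: no_term_divisible_def)
    qed
    have DD1: "(\<forall>i\<in>{1..k}. \<forall>j\<in>{1..k}. j < i \<longrightarrow> no_term_divisible m n (q i \<odot> lm gt (g i)) (lm gt (g j)))
      \<longleftrightarrow> (\<forall>i\<in>I. \<forall>a. coeff_at (q i) a \<noteq> 0 \<longrightarrow> (\<forall>j\<in>I. j < i \<longrightarrow> \<not> vmon_dvd m n (w j) (lead_multiple i a)))"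
      (is "?L \<longleftrightarrow> _")
    proof -
      have "?L \<longleftrightarrow> (\<forall>i\<in>I. \<forall>j\<in>I. j < i \<longrightarrow> no_term_divisible m n (q i \<odot> lm gt (g i)) (lm gt (g j)))"
        using I_sub dvd0 no_term0 by blast
      also have "\<dots> \<longleftrightarrow> (\<forall>i\<in>I. \<forall>j\<in>I. j < i \<longrightarrow>
          (\<forall>a. coeff_at (q i) a \<noteq> 0 \<longrightarrow> \<not> vmon_dvd m n (w j) (lead_multiple i a)))"
      proof -
        have "no_term_divisible m n (q i \<odot> lm gt (g i)) (lm gt (g j)) \<longleftrightarrow>
            (\<forall>a. coeff_at (q i) a \<noteq> 0 \<longrightarrow> \<not> vmon_dvd m n (w j) (lead_multiple i a))" if "i \<in> I" "j \<in> I" for i j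
          unfolding w(1)[OF that(1)] w(1)[OF that(2)] no_term_divisible_iff monomials_scale_vmon_elt lead_multiple_def
          by blast
        then show ?thesis by simp
      qed
      finally show ?thesis by blast
    qed
    have DD2: "(\<forall>i\<in>{1..k}. no_term_divisible m n r (lm gt (g i))) \<longleftrightarrow>
        (\<forall>i\<in>I. \<forall>v\<in>monomials r. \<not> vmon_dvd m n (w i) v)"
      using I_sub dvd0 by (metis no_term_divisible_iff subsetD w(1))
    have homogeneous_q: "q i \<in> poly_ring m n \<and> poly_xhomogeneous_of (?e - xdeg (lm gt (g i))) (q i) \<longleftrightarrow>
        (\<forall>a. coeff_at (q i) a \<noteq> 0 \<longrightarrow> lead_multiple i a \<in> D)" if i: "i \<in> I" for i
      unfolding poly_ring_iff poly_xhomogeneous_of_def xhomogeneous_of_def monomials_scale_unit_vec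
        w(1)[OF i] xdeg_vmon_elt lead_multiple_in_D[OF i, where j = 1]
      by (auto simp: ereal_eq_diff_iff)
    have homogeneous_r: "r \<in> free_module m n s \<and> xhomogeneous_of ?e r \<longleftrightarrow> (\<forall>v\<in>monomials r. v \<in> D)"
      by (auto simp: free_module_iff xhomogeneous_of_def graded_piece_def)
    have homogeneous_zero: "q i \<in> poly_ring m n \<and> poly_xhomogeneous_of (?e - xdeg (lm gt (g i))) (q i) \<longleftrightarrow> q i = 0"
      if "i \<in> {1..k}" "i \<notin> I" for i
      using zero_homogeneous[OF that] by (auto simp: poly_ring_iff)
    have homogeneous_all: "q \<in> {1..k} \<rightarrow>\<^sub>E poly_ring m n \<and>
        (\<forall>i\<in>{1..k}. poly_xhomogeneous_of (?e - xdeg (lm gt (g i))) (q i)) \<longleftrightarrow>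
      (\<forall>i. i \<notin> {1..k} \<longrightarrow> q i = undefined) \<and> (\<forall>i\<in>{1..k}. i \<notin> I \<longrightarrow> q i = 0) \<and>
      (\<forall>i\<in>I. \<forall>a. coeff_at (q i) a \<noteq> 0 \<longrightarrow> lead_multiple i a \<in> D)"
      unfolding PiE_iff extensional_def using homogeneous_q homogeneous_zero I_sub by blast
    have dvd_lead_multiple: "vmon_dvd m n (w i) (lead_multiple i a)" if "i \<in> I" "lead_multiple i a \<in> D" for i a
      using that lead_multiple_in_D[OF that(1), of a 0] by (auto simp: vmon_dvd_def lead_multiple_def)
    have adm: "admissible q r \<longleftrightarrow> (\<forall>i\<in>I. \<forall>a. coeff_at (q i) a \<noteq> 0 \<longrightarrow> lead_multiple i a \<in> D) \<and>
        (\<forall>i\<in>I. \<forall>a. coeff_at (q i) a \<noteq> 0 \<longrightarrow> (\<forall>j\<in>I. j < i \<longrightarrow> \<not> vmon_dvd m n (w j) (lead_multiple i a))) \<and>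
        (\<forall>v\<in>monomials r. v \<in> D) \<and> (\<forall>i\<in>I. \<forall>v\<in>monomials r. \<not> vmon_dvd m n (w i) v)"
      unfolding admissible_def least_divisor_def using dvd_lead_multiple by blast
    show ?thesis
      unfolding sum_I DD1 DD2 adm homogeneous_r[symmetric]
      using homogeneous_all by (elim iffE) (intro iffI conjI; elim conjE; assumption?; blast)
  qed
  obtain q\<^sub>0 r\<^sub>0 where qr: "admissible q\<^sub>0 r\<^sub>0" "f = (\<Sum>i\<in>I. q\<^sub>0 i \<odot> g i) + r\<^sub>0"
    and unique: "\<And>q r. admissible q r \<Longrightarrow> f = (\<Sum>i\<in>I. q i \<odot> g i) + r \<Longrightarrow> (\<forall>i\<in>I. q i = q\<^sub>0 i) \<and> r = r\<^sub>0"
    by (rule division_exists_unique[OF f_in]) blast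
  define q\<^sub>1 where "q\<^sub>1 i = (if i \<in> I then q\<^sub>0 i else if i \<in> {1..k} then 0 else undefined)" for i
  have "?P q\<^sub>1 r\<^sub>0"
  proof (unfold P_iff, intro conjI)
    have q1: "q\<^sub>1 i = q\<^sub>0 i" if "i \<in> I" for i using that by (simp add: q\<^sub>1_def)
    then show "admissible q\<^sub>1 r\<^sub>0" using qr(1) by (simp add: admissible_def)
    show "f = (\<Sum>i\<in>I. q\<^sub>1 i \<odot> g i) + r\<^sub>0" using qr(2) q1 by simp
    show "\<forall>i. i \<notin> {1..k} \<longrightarrow> q\<^sub>1 i = undefined" by (auto simp: q\<^sub>1_def I_def)
  qed (simp add: q\<^sub>1_def)
  moreover have "q = q\<^sub>1 \<and> r = r\<^sub>0" if "?P q r" for q r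
  proof
    from that have *: "\<And>i. i \<notin> {1..k} \<Longrightarrow> q i = undefined"
        "\<And>i. i \<in> {1..k} \<Longrightarrow> i \<notin> I \<Longrightarrow> q i = 0"
        "admissible q r" "f = (\<Sum>i\<in>I. q i \<odot> g i) + r"
      unfolding P_iff by blast+
    from unique[OF *(3,4)] have eq: "\<And>i. i \<in> I \<Longrightarrow> q i = q\<^sub>0 i" and "r = r\<^sub>0" by blast+
    show "q = q\<^sub>1" unfolding q\<^sub>1_def using *(1,2) eq by (intro ext) presburger
    show "r = r\<^sub>0" by fact
  qed
  ultimately show ?thesis
    by (intro ex1I[of _ "(q\<^sub>1, r\<^sub>0)"]) (simp, clarify, blast)
qed

end
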